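(* Let $p\ge3$ be an integer. For every $k\ge1$ there exist $K_1(p,k),K_2(p,k),c_p>0$, with $K_1$ of at most polynomial growth in $p$, such that (1) $\limsup_{N\to\infty}\frac1N\log\mathbb P(\|H\|_{\mathcal G^k}\ge K_1N)\le-c_p$; (2) for $k=1,2$, $\limsup_{N\to\infty}\frac1N\log\mathbb P(\|H\|_{\dot W^{k,\infty}}\ge K_2\sqrt N)\le-c_p$.
   Context: $\mathcal S^N=\{x\in\mathbb R^N:\sum x_i^2=N\}$ with its induced metric and covariant derivative $\nabla$. $H(x)=N^{-(p-1)/2}\sum_{i_1,\dots,i_p=1}^NJ_{i_1\dots i_p}x_{i_1}\cdots x_{i_p}$ with i.i.d. standard Gaussian $J$ of law $\mathbb P$. For $f\in C^\infty(\mathcal S^N)$, $|\nabla^\ell f|_{op}(x)$ is the operator norm of the $\ell$-form $\nabla^\ell f(x)$ on the $\ell$-fold product of $T_x\mathcal S^N$ (i.e. the supremum of $\nabla^\ell f(x)(X_1,\dots,X_\ell)$ over unit $X_i\in T_x\mathcal S^N$), and $\|f\|_{\mathcal G^k}=\sum_{0\le\ell\le k}N^{\ell/2}\|\,|\nabla^\ell f|_{op}\|_{L^\infty(\mathcal S^N)}$. The homogeneous Sobolev norm is $\|f\|_{\dot W^{k,\infty}}=\|\sqrt{\langle\nabla^kf,\nabla^kf\rangle}\|_{L^\infty(\mathcal S^N)}$ (Frobenius/Hilbert–Schmidt norm of the tensor). *)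

theory Defs
  imports "HOL-Probability.Probability"
begin

text \<open>Points of R^N are represented as functions nat => real; only the coordinates
  0..N-1 are relevant (points of the sphere vanish outside them).\<close>

definition ip :: "nat \<Rightarrow> (nat \<Rightarrow> real) \<Rightarrow> (nat \<Rightarrow> real) \<Rightarrow> real" where
  "ip N x y = (\<Sum>i<N. x i * y i)"

definition sphereN :: "nat \<Rightarrow> (nat \<Rightarrow> real) set" where
  "sphereN N = {x. (\<forall>i\<ge>N. x i = 0) \<and> ip N x x = real N}"

definition unit_tangent :: "nat \<Rightarrow> (nat \<Rightarrow> real) \<Rightarrow> (nat \<Rightarrow> real) \<Rightarrow> bool" where
  "unit_tangent N x v \<longleftrightarrow> (\<forall>i\<ge>N. v i = 0) \<and> ip N x v = 0 \<and> ip N v v = 1"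

definition proj :: "nat \<Rightarrow> (nat \<Rightarrow> real) \<Rightarrow> (nat \<Rightarrow> real) \<Rightarrow> (nat \<Rightarrow> real)" where
  "proj N x v = (\<lambda>i. if i < N then v i - ip N x v / ip N x x * x i else 0)"

text \<open>Iterated covariant derivative (Levi-Civita connection of the induced metric)
  of the restriction to the sphere of an ambient function F, evaluated at
  x and at the vectors vs (length vs = l).  For x on the sphere and vs tangent at x,
  covd l N F x vs = (nabla^l f)(x)(vs), because the tangent vector fields
  y |-> proj y v (v tangent at x) have vanishing covariant derivative at x.\<close>
primrec covd :: "nat \<Rightarrow> nat \<Rightarrow> ((nat \<Rightarrow> real) \<Rightarrow> real) \<Rightarrow> (nat \<Rightarrow> real) \<Rightarrow> (nat \<Rightarrow> real) list \<Rightarrow> real" where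
  "covd 0 N F x vs = F x"
| "covd (Suc l) N F x vs =
     deriv (\<lambda>t. covd l N F (\<lambda>i. x i + t * proj N x (hd vs) i)
                 (map (proj N (\<lambda>i. x i + t * proj N x (hd vs) i)) (tl vs))) 0"

definition opnorm :: "nat \<Rightarrow> nat \<Rightarrow> ((nat \<Rightarrow> real) \<Rightarrow> real) \<Rightarrow> (nat \<Rightarrow> real) \<Rightarrow> real" where
  "opnorm l N F x = Sup {\<bar>covd l N F x vs\<bar> | vs. length vs = l \<and> (\<forall>v\<in>set vs. unit_tangent N x v)}"

definition Gnorm :: "nat \<Rightarrow> nat \<Rightarrow> ((nat \<Rightarrow> real) \<Rightarrow> real) \<Rightarrow> real" where
  "Gnorm k N F = (\<Sum>l\<le>k. real N powr (real l / 2) * (SUP x\<in>sphereN N. opnorm l N F x))"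

definition basis_vec :: "nat \<Rightarrow> nat \<Rightarrow> real" where
  "basis_vec j = (\<lambda>i. if i = j then 1 else 0)"

text \<open>Hilbert-Schmidt norm squared <nabla^k f, nabla^k f>(x), computed by summing over
  the projections of the ambient standard basis (a Parseval frame of the tangent space).\<close>
definition hs_sq :: "nat \<Rightarrow> nat \<Rightarrow> ((nat \<Rightarrow> real) \<Rightarrow> real) \<Rightarrow> (nat \<Rightarrow> real) \<Rightarrow> real" where
  "hs_sq k N F x = (\<Sum>is\<in>{is. length is = k \<and> set is \<subseteq> {..<N}}.
                     (covd k N F x (map (\<lambda>j. proj N x (basis_vec j)) is))\<^sup>2)"

definition Wnorm :: "nat \<Rightarrow> nat \<Rightarrow> ((nat \<Rightarrow> real) \<Rightarrow> real) \<Rightarrow> real" where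
  "Wnorm k N F = (SUP x\<in>sphereN N. sqrt (hs_sq k N F x))"

definition idx :: "nat \<Rightarrow> nat \<Rightarrow> nat list set" where
  "idx p N = {is. length is = p \<and> set is \<subseteq> {..<N}}"

definition disorder :: "nat \<Rightarrow> nat \<Rightarrow> (nat list \<Rightarrow> real) measure" where
  "disorder p N = PiM (idx p N) (\<lambda>_. std_normal_distribution)"

definition Ham :: "nat \<Rightarrow> nat \<Rightarrow> (nat list \<Rightarrow> real) \<Rightarrow> (nat \<Rightarrow> real) \<Rightarrow> real" where
  "Ham p N J x = real N powr (- (real p - 1) / 2) *
     (\<Sum>is\<in>idx p N. J is * (\<Prod>j<p. x (is ! j)))"

end

theory Submission
  imports Defs
begin

text \<open>Write \<open>H(x) = N powr (- (p - 1) / 2) * T(x, \<dots>, x)\<close> with a Gaussian \<open>p\<close>-linear form \<open>T\<close>. The covariant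
  derivative \<open>\<nabla>\<^sup>l H\<close> is a sum of \<open>p ^ l\<close> terms, each a product of inner products of the tangent
  vectors, a power of \<open>\<bar>x\<bar>\<close>, and a value of \<open>T\<close> at \<open>x\<close> and the tangent vectors; by homogeneity it is
  bounded by \<open>p ^ l * N powr (1/2 - l/2)\<close> times the supremum of \<open>\<bar>T\<bar>\<close> over unit vectors. The
  Hilbert--Schmidt norm gains at most \<open>\<surd>N\<close> for each vector after the first, because the
  form is linear in the first one.

  The supremum of \<open>T\<close> exceeds \<open>12 * p\<^sup>2 * \<surd>N\<close> with probability at most \<open>exp (- N)\<close>: being affine
  in every coordinate of every argument, \<open>T\<close> does not decrease when each coordinate is rounded to
  a suitable neighbour in a grid of mesh \<open>1 / (p * \<surd>N)\<close>. The rounded vectors have norm at most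
  \<open>1 + 1/p\<close>, so there are only exponentially many of them in \<open>N\<close>, the variance of \<open>T\<close> there is at
  most \<open>(1 + 1/p) ^ (2 * p) \<le> 9\<close>, and a union bound applies.\<close>

section \<open>Gaussian product measures\<close>

abbreviation gaussian_product :: "'i set \<Rightarrow> ('i \<Rightarrow> real) measure" where
  "gaussian_product I \<equiv> PiM I (\<lambda>_. std_normal_distribution)"

text \<open>Completing the square: tilting the standard density by \<open>exp (t * x)\<close> gives
  \<open>exp (t\<^sup>2 / 2)\<close> times the density with mean \<open>t\<close>, which integrates
  to one.\<close>

lemma nn_integral_exp_std_normal:
  "(\<integral>\<^sup>+x. ennreal (exp (t * x)) \<partial>std_normal_distribution) = ennreal (exp (t\<^sup>2 / 2))"
proof -
  have eq: "std_normal_density x * exp (t * x) = exp (t\<^sup>2 / 2) * normal_density t 1 x" for x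
  proof -
    have "exp (- x\<^sup>2 / 2) * exp (t * x) = exp (t\<^sup>2 / 2) * exp (- (x - t)\<^sup>2 / 2)"
      unfolding exp_add[symmetric] by (rule arg_cong[of _ _ exp]) (simp add: power2_eq_square field_simps)
    then show ?thesis by (simp add: normal_density_def)
  qed
  have "(\<integral>\<^sup>+x. ennreal (exp (t * x)) \<partial>std_normal_distribution)
      = (\<integral>\<^sup>+x. ennreal (std_normal_density x) * ennreal (exp (t * x)) \<partial>lborel)"
    by (subst nn_integral_density) auto
  also have "\<dots> = (\<integral>\<^sup>+x. ennreal (exp (t\<^sup>2 / 2)) * ennreal (normal_density t 1 x) \<partial>lborel)"
    by (intro nn_integral_cong) (simp add: ennreal_mult'[symmetric] normal_density_nonneg eq)
  also have "\<dots> = ennreal (exp (t\<^sup>2 / 2)) * (\<integral>\<^sup>+x. ennreal (normal_density t 1 x) \<partial>lborel)"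
    by (rule nn_integral_cmult) auto
  also have "(\<integral>\<^sup>+x. ennreal (normal_density t 1 x) \<partial>lborel) = 1"
    by (subst nn_integral_eq_integral) (auto simp: normal_density_nonneg integral_normal_density)
  finally show ?thesis by simp
qed

lemma product_prob_space_std_normal: "product_prob_space (\<lambda>_. std_normal_distribution)"
proof -
  have "prob_space std_normal_distribution"
    by (rule prob_space_normal_density) simp
  then show ?thesis by (auto intro: product_prob_spaceI)
qed

lemma prob_space_gaussian_product: "prob_space (gaussian_product I)"
proof -
  interpret product_prob_space "\<lambda>_::'a. std_normal_distribution" I
    by (rule product_prob_space_std_normal)
  show ?thesis by unfold_locales
qed

text \<open>Chernoff bound: by independence the exponential moment of the linear form factorises
  over the coordinates. Only an upper bound \<open>V\<close> on the variance enters, so one estimate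
  serves all grid points.\<close>

lemma gaussian_linear_tail:
  fixes z :: "'i \<Rightarrow> real"
  assumes fin: "finite I" and V: "(\<Sum>i\<in>I. (z i)\<^sup>2) \<le> V" "V > 0" and B: "B \<ge> 0"
  shows "measure (gaussian_product I) {J \<in> space (gaussian_product I). (\<Sum>i\<in>I. J i * z i) \<ge> B}
          \<le> exp (- B\<^sup>2 / (2 * V))"
proof -
  interpret P: product_prob_space "\<lambda>_::'i. std_normal_distribution" I
    by (rule product_prob_space_std_normal)
  let ?M = "gaussian_product I"
  \<comment> \<open>The minimiser of \<open>- t * B + t\<^sup>2 / 2 * V\<close>.\<close>
  define t where "t = B / V"
  have t: "t \<ge> 0" using V B by (simp add: t_def)
  let ?u = "\<lambda>J. ennreal (exp (t * (\<Sum>i\<in>I. J i * z i)))"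
  have "emeasure ?M {J \<in> space ?M. (\<Sum>i\<in>I. J i * z i) \<ge> B}
      \<le> emeasure ?M {J \<in> space ?M. 1 \<le> ennreal (exp (- t * B)) * ?u J}"
  proof (rule emeasure_mono)
    show "{J \<in> space ?M. (\<Sum>i\<in>I. J i * z i) \<ge> B} \<subseteq> {J \<in> space ?M. 1 \<le> ennreal (exp (- t * B)) * ?u J}"
    proof safe
      fix J assume "B \<le> (\<Sum>i\<in>I. J i * z i)"
      then have "t * B \<le> t * (\<Sum>i\<in>I. J i * z i)" using t by (rule mult_left_mono)
      then have "1 \<le> exp (- t * B + t * (\<Sum>i\<in>I. J i * z i))" by simp
      then show "1 \<le> ennreal (exp (- t * B)) * ?u J"
        by (simp only: exp_add ennreal_mult'[symmetric] exp_ge_zero ennreal_1[symmetric] ennreal_leI)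
    qed
    show "{J \<in> space ?M. 1 \<le> ennreal (exp (- t * B)) * ?u J} \<in> sets ?M" by measurable
  qed
  also have "\<dots> \<le> ennreal (exp (- t * B)) * (\<integral>\<^sup>+J. ?u J * indicator (space ?M) J \<partial>?M)"
    by (rule nn_integral_Markov_inequality) auto
  also have "(\<integral>\<^sup>+J. ?u J * indicator (space ?M) J \<partial>?M) = (\<integral>\<^sup>+J. (\<Prod>i\<in>I. ennreal (exp ((t * z i) * J i))) \<partial>?M)"
    by (intro nn_integral_cong)
      (simp add: prod_ennreal exp_sum[OF fin, symmetric] sum_distrib_left mult_ac)
  also have "\<dots> = (\<Prod>i\<in>I. (\<integral>\<^sup>+x. ennreal (exp ((t * z i) * x)) \<partial>std_normal_distribution))"
    by (rule P.product_nn_integral_prod[OF fin]) auto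
  also have "\<dots> = ennreal (exp (t\<^sup>2 / 2 * (\<Sum>i\<in>I. (z i)\<^sup>2)))"
    by (simp add: nn_integral_exp_std_normal prod_ennreal exp_sum[OF fin, symmetric]
        sum_distrib_left power_mult_distrib)
  also have "ennreal (exp (- t * B)) * \<dots> = ennreal (exp (- t * B + t\<^sup>2 / 2 * (\<Sum>i\<in>I. (z i)\<^sup>2)))"
    by (simp add: exp_add[symmetric] ennreal_mult'[symmetric])
  also have "\<dots> \<le> ennreal (exp (- B\<^sup>2 / (2 * V)))"
  proof -
    have "t\<^sup>2 / 2 * (\<Sum>i\<in>I. (z i)\<^sup>2) \<le> t\<^sup>2 / 2 * V" by (rule mult_left_mono[OF V(1)]) simp
    also have "\<dots> = B\<^sup>2 / (2 * V)" using V by (simp add: t_def power2_eq_square field_simps)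
    finally have "t\<^sup>2 / 2 * (\<Sum>i\<in>I. (z i)\<^sup>2) \<le> B\<^sup>2 / (2 * V)" .
    moreover have "t * B = 2 * (B\<^sup>2 / (2 * V))" by (simp add: t_def power2_eq_square)
    ultimately show ?thesis by (intro ennreal_leI) simp
  qed
  finally show ?thesis by (simp add: measure_def enn2real_leI)
qed

text \<open>The density is positive everywhere, so a null interval would also be Lebesgue
  null.\<close>

lemma std_normal_interval_pos:
  assumes "a < b"
  shows "measure std_normal_distribution {a<..<b} > 0"
proof -
  interpret prob_space std_normal_distribution
    by (rule prob_space_normal_density) simp
  have "{a<..<b} \<notin> null_sets std_normal_distribution"
  proof
    assume "{a<..<b} \<in> null_sets std_normal_distribution"
    then have "AE x in lborel. x \<in> {a<..<b} \<longrightarrow> ennreal (std_normal_density x) = 0"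
      by (subst (asm) null_sets_density_iff) auto
    moreover have "std_normal_density x > 0" for x by (simp add: normal_density_pos)
    ultimately have "AE x in lborel. x \<notin> {a<..<b}"
      by (auto elim!: eventually_mono simp: ennreal_eq_0_iff not_le[symmetric])
    then have "{a<..<b} \<in> null_sets lborel"
      by (subst AE_iff_null_sets) auto
    then show False using assms by (simp add: null_sets_def)
  qed
  then show ?thesis by (simp add: null_sets_def emeasure_eq_measure zero_less_measure_iff)
qed

lemma gaussian_product_box_pos:
  fixes a b :: "'i \<Rightarrow> real"
  assumes "finite I" "\<And>i. i \<in> I \<Longrightarrow> a i < b i"
  shows "measure (gaussian_product I) (PiE I (\<lambda>i. {a i<..<b i})) > 0"
proof -
  interpret P: finite_product_prob_space "\<lambda>_::'i. std_normal_distribution" I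
    unfolding finite_product_prob_space_def finite_product_sigma_finite_def
      finite_product_sigma_finite_axioms_def
    using product_prob_space_std_normal[where 'a='i] assms(1)
    by (auto simp: product_prob_space_def)
  have "measure (gaussian_product I) (PiE I (\<lambda>i. {a i<..<b i}))
      = (\<Prod>i\<in>I. measure std_normal_distribution {a i<..<b i})"
    by (rule P.prob_times) auto
  also have "\<dots> > 0" by (intro prod_pos ballI std_normal_interval_pos assms)
  finally show ?thesis .
qed

section \<open>Lipschitz functionals of the disorder\<close>

text \<open>The inequality ranges over all total functions while the sum runs over \<open>I\<close>
  only, so \<open>\<Phi>\<close> ignores every coordinate outside \<open>I\<close>.\<close>

definition l1_lipschitz :: "'i set \<Rightarrow> (('i \<Rightarrow> real) \<Rightarrow> real) \<Rightarrow> bool" where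
  "l1_lipschitz I \<Phi> \<longleftrightarrow> (\<exists>L. \<forall>J J'. \<bar>\<Phi> J - \<Phi> J'\<bar> \<le> L * (\<Sum>i\<in>I. \<bar>J i - J' i\<bar>))"

text \<open>The Lipschitz bound makes \<open>\<Phi>\<close> continuous for the product topology. For
  a countable index type the Borel sets of that topology are the product sigma-algebra.\<close>

lemma l1_lipschitz_measurable:
  fixes \<Phi> :: "('i::countable \<Rightarrow> real) \<Rightarrow> real"
  assumes L: "l1_lipschitz I \<Phi>"
  shows "\<Phi> \<in> borel_measurable (gaussian_product I)"
proof -
  obtain L where L: "\<And>J J'. \<bar>\<Phi> J - \<Phi> J'\<bar> \<le> L * (\<Sum>i\<in>I. \<bar>J i - J' i\<bar>)"
    using L by (auto simp: l1_lipschitz_def)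
  have cont: "continuous_on UNIV \<Phi>"
  proof (clarsimp simp: continuous_on_def)
    fix J :: "'i \<Rightarrow> real"
    have c: "((\<lambda>J'. J' i) \<longlongrightarrow> J i) (at J)" for i
      using continuous_on_product_coordinates[of i] by (auto simp: continuous_on_def)
    have "((\<lambda>J'. L * (\<Sum>i\<in>I. \<bar>J' i - J i\<bar>)) \<longlongrightarrow> L * (\<Sum>i\<in>I. \<bar>J i - J i\<bar>)) (at J)"
      by (intro tendsto_intros c)
    then have "((\<lambda>J'. L * (\<Sum>i\<in>I. \<bar>J' i - J i\<bar>)) \<longlongrightarrow> 0) (at J)" by simp
    then have "((\<lambda>J'. \<Phi> J' - \<Phi> J) \<longlongrightarrow> 0) (at J)"
      by (rule Lim_null_comparison[rotated]) (use L in auto)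
    then show "(\<Phi> \<longlongrightarrow> \<Phi> J) (at J)" by (rule Lim_null[THEN iffD2])
  qed
  then have m: "\<Phi> \<in> borel_measurable (PiM UNIV (\<lambda>_. borel))"
    using borel_measurable_continuous_onI measurable_cong_sets[OF sets_PiM_equal_borel refl] by blast
  \<comment> \<open>Extension by zero maps the product over \<open>I\<close> measurably into the
    full function space and does not change \<open>\<Phi>\<close>.\<close>
  have e: "(\<lambda>J i. if i \<in> I then J i else 0) \<in> measurable (gaussian_product I) (PiM UNIV (\<lambda>_. borel))"
  proof (rule measurable_PiM_single')
    show "(\<lambda>J. if i \<in> I then J i else 0) \<in> borel_measurable (gaussian_product I)" for i
      by (cases "i \<in> I") auto
  qed auto
  have eq: "\<Phi> (\<lambda>i. if i \<in> I then J i else 0) = \<Phi> J" for J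
    using L[of "\<lambda>i. if i \<in> I then J i else 0" J] by simp
  show ?thesis using measurable_compose[OF e m] by (simp add: eq)
qed

text \<open>A small open box around \<open>J0\<close> lies in the event, and boxes have positive
  Gaussian measure.\<close>

lemma l1_lipschitz_event_pos:
  fixes \<Phi> :: "('i::countable \<Rightarrow> real) \<Rightarrow> real"
  assumes L: "l1_lipschitz I \<Phi>" and fin: "finite I" and J0: "\<Phi> J0 > r"
  shows "measure (gaussian_product I) {J \<in> space (gaussian_product I). \<Phi> J \<ge> r} > 0"
proof -
  interpret prob_space "gaussian_product I" by (rule prob_space_gaussian_product)
  have [measurable]: "\<Phi> \<in> borel_measurable (gaussian_product I)"
    by (rule l1_lipschitz_measurable[OF L])
  obtain L where L: "\<And>J J'. \<bar>\<Phi> J - \<Phi> J'\<bar> \<le> L * (\<Sum>i\<in>I. \<bar>J i - J' i\<bar>)"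
    using L by (auto simp: l1_lipschitz_def)
  \<comment> \<open>The added ones keep the denominator positive when \<open>L = 0\<close> or
    \<open>I\<close> is empty.\<close>
  define d where "d = (\<Phi> J0 - r) / ((\<bar>L\<bar> + 1) * (real (card I) + 1))"
  have d: "d > 0" using J0 by (simp add: d_def)
  let ?B = "PiE I (\<lambda>i. {J0 i - d<..<J0 i + d})"
  have "0 < measure (gaussian_product I) ?B"
    by (rule gaussian_product_box_pos[OF fin]) (use d in auto)
  also have "\<dots> \<le> measure (gaussian_product I) {J \<in> space (gaussian_product I). \<Phi> J \<ge> r}"
  proof (rule finite_measure_mono)
    show "?B \<subseteq> {J \<in> space (gaussian_product I). \<Phi> J \<ge> r}"
    proof safe
      fix J assume J: "J \<in> ?B"
      then show "J \<in> space (gaussian_product I)" by (auto simp: space_PiM PiE_def)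
      have "(\<Sum>i\<in>I. \<bar>J0 i - J i\<bar>) \<le> (\<Sum>i\<in>I. d)"
        using J by (intro sum_mono) (force simp: PiE_def Pi_def abs_le_iff)
      then have s: "(\<Sum>i\<in>I. \<bar>J0 i - J i\<bar>) \<le> (real (card I) + 1) * d" using d by (simp add: algebra_simps)
      have "\<Phi> J0 - \<Phi> J \<le> L * (\<Sum>i\<in>I. \<bar>J0 i - J i\<bar>)" using L[of J0 J] by simp
      also have "\<dots> \<le> (\<bar>L\<bar> + 1) * (\<Sum>i\<in>I. \<bar>J0 i - J i\<bar>)"
        by (rule mult_right_mono) (auto intro: sum_nonneg)
      also have "\<dots> \<le> (\<bar>L\<bar> + 1) * ((real (card I) + 1) * d)"
        by (rule mult_left_mono[OF s]) simp
      also have "\<dots> = \<Phi> J0 - r" by (simp add: d_def)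
      finally show "r \<le> \<Phi> J" by simp
    qed
  qed measurable
  finally show ?thesis .
qed

text \<open>The lower bound \<open>0 < P N\<close> lets the logarithm be taken monotonically: with
  \<open>ln 0 = 0\<close>, a null event would contribute the value 0 and not minus infinity.\<close>

lemma limsup_log_prob_le:
  fixes P :: "nat \<Rightarrow> real"
  assumes "eventually (\<lambda>N. 0 < P N \<and> P N \<le> exp (- (c * real N))) sequentially"
  shows "limsup (\<lambda>N. ereal (1 / real N * ln (P N))) \<le> ereal (- c)"
proof (rule Limsup_bounded)
  show "\<forall>\<^sub>F N in sequentially. ereal (1 / real N * ln (P N)) \<le> ereal (- c)"
    using assms eventually_gt_at_top[of 0]
  proof eventually_elim
    case (elim N)
    then have "ln (P N) \<le> - (c * real N)" by (metis exp_le_cancel_iff exp_ln)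
    then show ?case using elim by (simp add: field_simps)
  qed
qed

section \<open>Multilinear forms\<close>

text \<open>The \<open>p\<close>-linear form with coefficient tensor \<open>J\<close>, with
  \<open>a j\<close> in slot \<open>j\<close>. Separate arguments allow rounding and differentiating
  one slot at a time.\<close>

definition mform :: "nat \<Rightarrow> nat \<Rightarrow> (nat list \<Rightarrow> real) \<Rightarrow> (nat \<Rightarrow> nat \<Rightarrow> real) \<Rightarrow> real" where
  "mform p N J a = (\<Sum>is\<in>idx p N. J is * (\<Prod>j<p. a j (is ! j)))"

lemma finite_idx [simp]: "finite (idx p N)"
  using finite_lists_length_eq[of "{..<N}" p] by (simp add: idx_def conj_commute)

lemma idx_0 [simp]: "idx 0 N = {[]}"
  by (auto simp: idx_def)

lemma sum_idx_Suc: "(\<Sum>is\<in>idx (Suc p) N. f is) = (\<Sum>i<N. \<Sum>is\<in>idx p N. f (i # is))"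
proof -
  have "idx (Suc p) N = (\<lambda>(i, is). i # is) ` ({..<N} \<times> idx p N)"
    by (auto simp: idx_def image_iff length_Suc_conv)
  moreover have "inj_on (\<lambda>(i, is). i # is) ({..<N} \<times> idx p N)" by (auto simp: inj_on_def)
  ultimately have "(\<Sum>is\<in>idx (Suc p) N. f is) = (\<Sum>x\<in>{..<N} \<times> idx p N. f (case x of (i, is) \<Rightarrow> i # is))"
    by (simp only: sum.reindex o_def)
  then show ?thesis by (simp add: sum.cartesian_product case_prod_beta)
qed

text \<open>Distributivity; it factorises the variance of the form over the slots.\<close>

lemma sum_idx_prod:
  fixes f :: "nat \<Rightarrow> nat \<Rightarrow> real"
  shows "(\<Sum>is\<in>idx p N. \<Prod>j<p. f j (is ! j)) = (\<Prod>j<p. \<Sum>i<N. f j i)"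
proof (induction p arbitrary: f)
  case (Suc p)
  have "(\<Sum>is\<in>idx (Suc p) N. \<Prod>j<Suc p. f j (is ! j))
      = (\<Sum>i<N. f 0 i * (\<Sum>is\<in>idx p N. \<Prod>j<p. f (Suc j) (is ! j)))"
    by (simp add: sum_idx_Suc prod.lessThan_Suc_shift sum_distrib_left del: prod.lessThan_Suc)
  also have "\<dots> = (\<Sum>i<N. f 0 i) * (\<Prod>j<p. \<Sum>i<N. f (Suc j) i)"
    by (simp only: Suc.IH[of "\<lambda>j. f (Suc j)"] sum_distrib_right)
  finally show ?case by (simp only: prod.lessThan_Suc_shift)
qed simp

lemma idx_nth: "is \<in> idx p N \<Longrightarrow> j < p \<Longrightarrow> is ! j < N"
  using nth_mem[of j "is"] unfolding idx_def by blast

lemma mform_cong: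
  assumes "\<And>j i. j < p \<Longrightarrow> i < N \<Longrightarrow> a j i = b j i"
  shows "mform p N J a = mform p N J b"
  unfolding mform_def using assms idx_nth by (auto intro!: sum.cong prod.cong)

lemma mform_diff: "mform p N J a - mform p N J' a = mform p N (\<lambda>is. J is - J' is) a"
  by (simp add: mform_def sum_subtractf left_diff_distrib)

lemma mform_scale_coeff: "mform p N (\<lambda>is. c * J is) a = c * mform p N J a"
  by (simp add: mform_def sum_distrib_left mult_ac)

lemma mform_scale: "mform p N J (\<lambda>j i. c j * b j i) = (\<Prod>j<p. c j) * mform p N J b"
  by (simp add: mform_def sum_distrib_left prod.distrib mult_ac)

lemma ip_cong: "(\<And>i. i < N \<Longrightarrow> x i = x' i) \<Longrightarrow> (\<And>i. i < N \<Longrightarrow> y i = y' i) \<Longrightarrow> ip N x y = ip N x' y'"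
  by (simp add: ip_def)

lemma ip_commute: "ip N x y = ip N y x"
  by (simp add: ip_def mult.commute)

lemma ip_nonneg [simp]: "ip N x x \<ge> 0"
  by (simp add: ip_def sum_nonneg)

lemma mform_slot_prod:
  assumes "j < p"
  shows "mform p N J (a(j := v)) = (\<Sum>is\<in>idx p N. J is * (v (is ! j) * (\<Prod>k\<in>{..<p}-{j}. a k (is ! k))))"
  unfolding mform_def using assms
  by (auto intro!: sum.cong prod.cong simp: prod.remove[of "{..<p}" j])

lemma basis_vec_expand: "m < N \<Longrightarrow> v m = (\<Sum>i<N. v i * basis_vec i m)"
  by (simp add: basis_vec_def if_distrib[of "(*) _"] cong: if_cong)

text \<open>Linearity in one slot, in Riesz form: the representing vector collects the values at the
  basis vectors. Rounding and the Hilbert--Schmidt estimate both need this vector.\<close>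

lemma mform_slot_linear:
  assumes "j < p"
  shows "mform p N J (a(j := v)) = ip N (\<lambda>i. mform p N J (a(j := basis_vec i))) v"
proof -
  have "mform p N J (a(j := v))
      = (\<Sum>is\<in>idx p N. \<Sum>i<N. J is * (v i * basis_vec i (is ! j) * (\<Prod>k\<in>{..<p}-{j}. a k (is ! k))))"
    unfolding mform_slot_prod[OF assms]
    by (intro sum.cong refl, subst basis_vec_expand[of _ N])
      (use assms idx_nth in \<open>auto simp: sum_distrib_left sum_distrib_right\<close>)
  also have "\<dots> = (\<Sum>i<N. (\<Sum>is\<in>idx p N. J is * (basis_vec i (is ! j) * (\<Prod>k\<in>{..<p}-{j}. a k (is ! k)))) * v i)"
    by (subst sum.swap) (simp add: sum_distrib_left mult_ac)
  finally show ?thesis by (simp add: mform_slot_prod[OF assms] ip_def)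
qed

lemma mform_neg_slot:
  assumes "j < p"
  shows "mform p N J (a(j := (\<lambda>i. - a j i))) = - mform p N J a"
  using mform_slot_linear[OF assms, of N J a "\<lambda>i. - a j i"] mform_slot_linear[OF assms, of N J a "a j"]
  by (simp add: ip_def sum_negf)

lemma has_field_derivative_mform:
  assumes "\<And>j i. j < p \<Longrightarrow> i < N \<Longrightarrow> ((\<lambda>t. a t j i) has_field_derivative a' j i) (at t0)"
  shows "((\<lambda>t. mform p N J (a t)) has_field_derivative (\<Sum>j<p. mform p N J ((a t0)(j := a' j)))) (at t0)"
proof -
  have "((\<lambda>t. mform p N J (a t)) has_field_derivative
      (\<Sum>is\<in>idx p N. J is * (\<Sum>j<p. a' j (is ! j) * (\<Prod>k\<in>{..<p}-{j}. a t0 k (is ! k))))) (at t0)"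
    unfolding mform_def
    by (intro DERIV_sum DERIV_cmult has_field_derivative_prod assms) (auto simp: idx_nth)
  also have "(\<Sum>is\<in>idx p N. J is * (\<Sum>j<p. a' j (is ! j) * (\<Prod>k\<in>{..<p}-{j}. a t0 k (is ! k))))
      = (\<Sum>j<p. mform p N J ((a t0)(j := a' j)))"
    by (simp add: mform_slot_prod sum_distrib_left sum.swap[of _ "{..<p}"])
  finally show ?thesis .
qed

text \<open>An upper bound for the injective norm of the tensor \<open>J\<close>, kept as a
  predicate so that no supremum has to be handled.\<close>

definition unit_bounded :: "nat \<Rightarrow> nat \<Rightarrow> (nat list \<Rightarrow> real) \<Rightarrow> real \<Rightarrow> bool" where
  "unit_bounded p N J B \<longleftrightarrow> (\<forall>a. (\<forall>j<p. ip N (a j) (a j) \<le> 1) \<longrightarrow> \<bar>mform p N J a\<bar> \<le> B)"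

text \<open>Coordinates of a vector in the unit ball are at most 1 in absolute value. This crude
  bound makes all suprema finite and yields the Lipschitz property.\<close>

lemma unit_bounded_l1: "unit_bounded p N J (\<Sum>is\<in>idx p N. \<bar>J is\<bar>)"
  unfolding unit_bounded_def
proof (intro allI impI)
  fix a :: "nat \<Rightarrow> nat \<Rightarrow> real" assume a: "\<forall>j<p. ip N (a j) (a j) \<le> 1"
  have c: "\<bar>a j i\<bar> \<le> 1" if "j < p" "i < N" for j i
  proof -
    have "a j i * a j i \<le> ip N (a j) (a j)"
      unfolding ip_def using that by (intro member_le_sum[of i _ "\<lambda>i. a j i * a j i"]) auto
    then show ?thesis using a that by (simp add: abs_square_le_1[symmetric] power2_eq_square) (meson order_trans)
  qed
  have "\<bar>mform p N J a\<bar> \<le> (\<Sum>is\<in>idx p N. \<bar>J is * (\<Prod>j<p. a j (is ! j))\<bar>)"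
    unfolding mform_def by (rule sum_abs)
  also have "\<dots> \<le> (\<Sum>is\<in>idx p N. \<bar>J is\<bar>)"
  proof (rule sum_mono)
    fix "is" assume i: "is \<in> idx p N"
    have "\<bar>\<Prod>j<p. a j (is ! j)\<bar> \<le> 1"
      unfolding abs_prod by (rule prod_le_1) (use c idx_nth[OF i] in auto)
    then show "\<bar>J is * (\<Prod>j<p. a j (is ! j))\<bar> \<le> \<bar>J is\<bar>"
      by (simp add: abs_mult mult_left_le)
  qed
  finally show "\<bar>mform p N J a\<bar> \<le> (\<Sum>is\<in>idx p N. \<bar>J is\<bar>)" .
qed

section \<open>Rounding to a grid\<close>

text \<open>Each coordinate is rounded up or down according to the sign of \<open>g i\<close>, so no
  term of the inner product decreases.\<close>

lemma linear_rounding: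
  fixes u g :: "nat \<Rightarrow> real"
  assumes "h > 0"
  shows "\<exists>n :: nat \<Rightarrow> int. (\<forall>i. \<bar>h * n i - u i\<bar> \<le> h) \<and> ip N g u \<le> ip N g (\<lambda>i. h * n i)"
proof -
  define n where "n i = (if g i \<ge> 0 then \<lceil>u i / h\<rceil> else \<lfloor>u i / h\<rfloor>)" for i
  have c: "h * \<lceil>u i / h\<rceil> \<ge> u i" "h * \<lceil>u i / h\<rceil> \<le> u i + h"
          "h * \<lfloor>u i / h\<rfloor> \<le> u i" "h * \<lfloor>u i / h\<rfloor> \<ge> u i - h" for i
  proof -
    define w where "w = u i / h"
    have w: "u i = h * w" using assms by (simp add: w_def)
    have "w \<le> \<lceil>w\<rceil>" "\<lceil>w\<rceil> \<le> w + 1" "\<lfloor>w\<rfloor> \<le> w" "w - 1 \<le> \<lfloor>w\<rfloor>"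
      by linarith+
    from this[THEN mult_left_mono, of h] show "h * \<lceil>u i / h\<rceil> \<ge> u i" "h * \<lceil>u i / h\<rceil> \<le> u i + h"
          "h * \<lfloor>u i / h\<rfloor> \<le> u i" "h * \<lfloor>u i / h\<rfloor> \<ge> u i - h"
      using assms unfolding w_def[symmetric] w by (simp_all add: algebra_simps)
  qed
  have "\<bar>h * n i - u i\<bar> \<le> h" for i
    using c[of i] assms by (auto simp: n_def)
  moreover have "g i * u i \<le> g i * (h * n i)" for i
    using c[of i] by (auto simp: n_def intro: mult_left_mono mult_left_mono_neg)
  ultimately show ?thesis unfolding ip_def by (meson sum_mono)
qed

text \<open>Induction on the number \<open>k\<close> of slots already rounded: with the others
  frozen, the form is linear in slot \<open>k\<close>.\<close>

lemma multilinear_rounding: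
  fixes u :: "nat \<Rightarrow> nat \<Rightarrow> real"
  assumes "h > 0" "k \<le> p"
  shows "\<exists>m :: nat \<Rightarrow> nat \<Rightarrow> int. (\<forall>j<k. \<forall>i. \<bar>h * m j i - u j i\<bar> \<le> h) \<and>
           mform p N J u \<le> mform p N J (\<lambda>j. if j < k then (\<lambda>i. h * m j i) else u j)"
  using assms(2)
proof (induction k)
  case (Suc k)
  then obtain m :: "nat \<Rightarrow> nat \<Rightarrow> int" where m: "\<forall>j<k. \<forall>i. \<bar>h * m j i - u j i\<bar> \<le> h"
    "mform p N J u \<le> mform p N J (\<lambda>j. if j < k then (\<lambda>i. h * m j i) else u j)" by auto
  let ?a = "\<lambda>j. if j < k then (\<lambda>i. h * m j i) else u j"
  have k: "k < p" using Suc by simp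
  obtain n :: "nat \<Rightarrow> int" where n: "\<forall>i. \<bar>h * n i - u k i\<bar> \<le> h"
    "ip N (\<lambda>i. mform p N J (?a(k := basis_vec i))) (u k)
      \<le> ip N (\<lambda>i. mform p N J (?a(k := basis_vec i))) (\<lambda>i. h * n i)"
    using linear_rounding[OF assms(1)] by blast
  have "mform p N J ?a = mform p N J (?a(k := u k))"
    by (rule mform_cong) auto
  also have "\<dots> \<le> mform p N J (?a(k := (\<lambda>i. h * n i)))"
    using n(2) by (simp only: mform_slot_linear[OF k, symmetric])
  also have "\<dots> = mform p N J (\<lambda>j. if j < Suc k then (\<lambda>i. h * (m(k := n)) j i) else u j)"
    by (rule mform_cong) (auto simp: less_Suc_eq)
  finally have "mform p N J u \<le> mform p N J (\<lambda>j. if j < Suc k then (\<lambda>i. h * (m(k := n)) j i) else u j)"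
    using m(2) by linarith
  moreover have "\<forall>j<Suc k. \<forall>i. \<bar>h * (m(k := n)) j i - u j i\<bar> \<le> h"
    using m(1) n(1) by (simp add: less_Suc_eq)
  ultimately show ?case by blast
qed simp

section \<open>Counting lattice points in a ball\<close>

text \<open>Lattice points of a ball of squared radius \<open>R\<close>, as extensional functions
  inside a finite box, so that they form a finite set.\<close>

definition grid :: "nat \<Rightarrow> nat \<Rightarrow> (nat \<Rightarrow> int) set" where
  "grid N R = {n \<in> PiE {..<N} (\<lambda>_. {- int R..int R}). (\<Sum>i<N. (n i)\<^sup>2) \<le> int R}"

lemma finite_grid: "finite (grid N R)"
  unfolding grid_def by (rule finite_subset[OF _ finite_PiE[of "{..<N}" "\<lambda>_. {- int R..int R}"]]) auto

text \<open>A truncated theta series, compared with a geometric series through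
  \<open>k \<le> k\<^sup>2\<close> for natural \<open>k\<close>.\<close>

lemma sum_half_power_square_le: "(\<Sum>k=- int R..int R. (1/2::real) ^ nat (k\<^sup>2)) \<le> 3"
proof -
  define f where "f k = (1/2::real) ^ nat (k\<^sup>2)" for k :: int
  \<comment> \<open>The strengthened bound leaves room \<open>(1/2) ^ R\<close> for the two new
    terms, each at most \<open>(1/2) ^ Suc R\<close>.\<close>
  have "(\<Sum>k=- int R..int R. f k) \<le> 3 - 2 * (1/2) ^ R"
  proof (induction R)
    case 0
    show ?case by (simp add: f_def)
  next
    case (Suc R)
    have "{- int (Suc R)..int (Suc R)} = insert (- int (Suc R)) (insert (int (Suc R)) {- int R..int R})"
      by auto
    then have "(\<Sum>k=- int (Suc R)..int (Suc R). f k)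
        = (\<Sum>k\<in>insert (- int (Suc R)) (insert (int (Suc R)) {- int R..int R}). f k)"
      by (rule arg_cong)
    also have "\<dots> = f (- int (Suc R)) + (\<Sum>k\<in>insert (int (Suc R)) {- int R..int R}. f k)"
      by (rule sum.insert) auto
    also have "(\<Sum>k\<in>insert (int (Suc R)) {- int R..int R}. f k) = f (int (Suc R)) + (\<Sum>k=- int R..int R. f k)"
      by (rule sum.insert) auto
    finally have "(\<Sum>k=- int (Suc R)..int (Suc R). f k)
        = f (- int (Suc R)) + (f (int (Suc R)) + (\<Sum>k=- int R..int R. f k))" .
    moreover have "f (- int (Suc R)) = f (int (Suc R))" unfolding f_def power2_minus ..
    moreover have "f (int (Suc R)) \<le> (1/2) ^ Suc R"
    proof -
      have "nat ((int (Suc R))\<^sup>2) = (Suc R)\<^sup>2" by (simp only: of_nat_power[symmetric] nat_int)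
      moreover have "Suc R \<le> (Suc R)\<^sup>2" by (simp add: power2_eq_square)
      ultimately show ?thesis unfolding f_def using power_decreasing[of "Suc R" "(Suc R)\<^sup>2" "1/2::real"] by simp
    qed
    ultimately have "(\<Sum>k=- int (Suc R)..int (Suc R). f k)
        \<le> 2 * (1/2) ^ Suc R + (\<Sum>k=- int R..int R. f k)" by linarith
    also have "\<dots> \<le> 2 * (1/2) ^ Suc R + (3 - 2 * (1/2) ^ R)"
      by (rule add_left_mono[OF Suc.IH])
    also have "\<dots> = 3 - 2 * (1/2) ^ Suc R" by simp
    finally show ?case .
  qed
  also have "\<dots> \<le> 3" by simp
  finally show ?thesis by (simp only: f_def)
qed

text \<open>Each lattice point is counted with the weight \<open>2 ^ (R - \<bar>n\<bar>\<^sup>2) \<ge> 1\<close>, which factorises over the coordinates.\<close>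

lemma card_grid_le: "real (card (grid N R)) \<le> 2 ^ R * 3 ^ N"
proof -
  let ?P = "PiE {..<N} (\<lambda>_. {- int R..int R})"
  have "real (card (grid N R)) = (\<Sum>n\<in>grid N R. 1)" by simp
  also have "\<dots> \<le> (\<Sum>n\<in>grid N R. 2 ^ R * (\<Prod>i<N. (1/2) ^ nat ((n i)\<^sup>2)))"
  proof (rule sum_mono)
    fix n assume n: "n \<in> grid N R"
    have "int (\<Sum>i<N. nat ((n i)\<^sup>2)) \<le> int R" using n by (simp add: grid_def)
    then have "(\<Sum>i<N. nat ((n i)\<^sup>2)) \<le> R" by linarith
    then have "(1/2::real) ^ R \<le> (1/2) ^ (\<Sum>i<N. nat ((n i)\<^sup>2))" by (rule power_decreasing) auto
    then have "2 ^ R * (1/2::real) ^ R \<le> 2 ^ R * (1/2) ^ (\<Sum>i<N. nat ((n i)\<^sup>2))" by (rule mult_left_mono) simp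
    moreover have "2 ^ R * (1/2::real) ^ R = 1" by (simp add: power_one_over)
    ultimately show "(1::real) \<le> 2 ^ R * (\<Prod>i<N. (1/2) ^ nat ((n i)\<^sup>2))"
      by (simp only: power_sum)
  qed
  also have "\<dots> \<le> (\<Sum>n\<in>?P. 2 ^ R * (\<Prod>i<N. (1/2) ^ nat ((n i)\<^sup>2)))"
  proof (rule sum_mono2)
    show "finite ?P" by (intro finite_PiE) auto
    show "grid N R \<subseteq> ?P" by (auto simp only: grid_def)
  qed (simp add: prod_nonneg)
  also have "\<dots> = 2 ^ R * (\<Prod>i<N. \<Sum>k=- int R..int R. (1/2) ^ nat (k\<^sup>2))"
    by (subst prod_sum_PiE) (auto simp: sum_distrib_left)
  also have "\<dots> \<le> 2 ^ R * (\<Prod>i<N. 3)"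
    by (intro mult_left_mono prod_mono conjI sum_half_power_square_le sum_nonneg) auto
  finally show ?thesis by simp
qed

text \<open>With mesh \<open>h = 1 / (p * sqrt N)\<close> the rounding error has norm at most
  \<open>1/p\<close>, so the rounded vector has norm at most \<open>1 + 1/p\<close>; dividing its
  square by \<open>h\<^sup>2\<close> gives the radius \<open>N * (p + 1)\<^sup>2\<close>.\<close>

lemma rounding_in_grid:
  fixes u :: "nat \<Rightarrow> real" and n :: "nat \<Rightarrow> int"
  assumes N: "N \<ge> 1" and p: "p \<ge> 1" and u: "ip N u u \<le> 1"
    and n: "\<forall>i. \<bar>1 / (real p * sqrt N) * n i - u i\<bar> \<le> 1 / (real p * sqrt N)"
  shows "restrict n {..<N} \<in> grid N (N * (p + 1)\<^sup>2)"
proof -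
  define h where "h = 1 / (real p * sqrt N)"
  define q where "q = real p"
  have q: "q \<ge> 1" using p by (simp add: q_def)
  have h2: "h\<^sup>2 * (q\<^sup>2 * N) = 1"
    using N p by (simp add: h_def q_def power_divide power_mult_distrib)
  \<comment> \<open>Young's inequality with weight \<open>q\<close>, applied coordinatewise in place
    of the triangle inequality; these weights lose nothing in the final constant.\<close>
  have step: "(h * n i)\<^sup>2 \<le> (1 + 1/q) * (u i)\<^sup>2 + (1 + q) * h\<^sup>2" for i
  proof -
    define d where "d = h * n i - u i"
    have "\<bar>d\<bar> \<le> \<bar>h\<bar>" using n h_def by (auto simp: d_def)
    then have d: "d\<^sup>2 \<le> h\<^sup>2" by (simp only: abs_le_square_iff)
    have "(u i + d)\<^sup>2 + (u i - q * d)\<^sup>2 / q = (1 + 1/q) * (u i)\<^sup>2 + (1 + q) * d\<^sup>2"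
      using q by (simp add: power2_eq_square field_simps)
    moreover have "(u i - q * d)\<^sup>2 / q \<ge> 0" using q by simp
    moreover have "(1 + q) * d\<^sup>2 \<le> (1 + q) * h\<^sup>2" using d q by (intro mult_left_mono) auto
    ultimately show ?thesis by (simp add: d_def)
  qed
  have "h\<^sup>2 * (\<Sum>i<N. (real_of_int (n i))\<^sup>2) = (\<Sum>i<N. (h * n i)\<^sup>2)"
    by (simp add: sum_distrib_left power_mult_distrib)
  also have "\<dots> \<le> (\<Sum>i<N. (1 + 1/q) * (u i)\<^sup>2 + (1 + q) * h\<^sup>2)" by (intro sum_mono step)
  also have "\<dots> = (1 + 1/q) * ip N u u + N * ((1 + q) * h\<^sup>2)"
    by (simp add: sum.distrib sum_distrib_left ip_def power2_eq_square)
  also have "\<dots> \<le> (1 + 1/q) * 1 + N * ((1 + q) * h\<^sup>2)"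
    using u q by (intro add_mono mult_left_mono) auto
  finally have "q\<^sup>2 * N * (h\<^sup>2 * (\<Sum>i<N. (real_of_int (n i))\<^sup>2))
      \<le> q\<^sup>2 * N * ((1 + 1/q) + N * ((1 + q) * h\<^sup>2))"
    by (intro mult_left_mono) auto
  also have "\<dots> = N * (q\<^sup>2 * (1 + 1/q)) + N * (1 + q) * (h\<^sup>2 * (q\<^sup>2 * N))"
    by (simp add: algebra_simps)
  also have "\<dots> = N * (q + 1)\<^sup>2"
    unfolding h2 using q by (simp add: power2_eq_square field_simps)
  finally have "(h\<^sup>2 * (q\<^sup>2 * N)) * (\<Sum>i<N. (real_of_int (n i))\<^sup>2) \<le> N * (q + 1)\<^sup>2"
    by (simp add: mult_ac)
  then have "real_of_int (\<Sum>i<N. (n i)\<^sup>2) \<le> real_of_int (int (N * (p + 1)\<^sup>2))"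
    unfolding h2 by (simp add: q_def add.commute)
  then have s: "(\<Sum>i<N. (n i)\<^sup>2) \<le> int (N * (p + 1)\<^sup>2)" by (simp only: of_int_le_iff)
  \<comment> \<open>An integer is bounded in absolute value by its square, so the norm bound places
    the point in the box.\<close>
  have "\<bar>n i\<bar> \<le> int (N * (p + 1)\<^sup>2)" if "i < N" for i
  proof -
    have "\<bar>n i\<bar> \<le> \<bar>n i\<bar> * \<bar>n i\<bar>"
      using mult_left_mono[of 1 "\<bar>n i\<bar>" "\<bar>n i\<bar>"] by (cases "n i = 0") auto
    also have "\<dots> = (n i)\<^sup>2" by (simp add: power2_eq_square)
    also have "\<dots> \<le> (\<Sum>i<N. (n i)\<^sup>2)"
      using that by (intro member_le_sum) auto
    finally show ?thesis using s by linarith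
  qed
  then have "- int (N * (p + 1)\<^sup>2) \<le> n i" "n i \<le> int (N * (p + 1)\<^sup>2)" if "i < N" for i
    using that by (meson abs_le_D1 abs_le_D2 minus_le_iff)+
  then show ?thesis using s unfolding grid_def
    by (auto simp: PiE_def simp del: of_nat_mult of_nat_power of_nat_add)
qed

section \<open>The Gaussian form on unit vectors\<close>

lemma unit_bounded_from_grid:
  assumes N: "N \<ge> 1" and p: "p \<ge> 1"
    and B: "\<forall>m \<in> PiE {..<p} (\<lambda>_. grid N (N * (p + 1)\<^sup>2)).
      mform p N J (\<lambda>j i. 1 / (real p * sqrt N) * m j i) \<le> B"
  shows "unit_bounded p N J B"
proof -
  define h where "h = 1 / (real p * sqrt N)"
  have h: "h > 0" using N p by (simp add: h_def)
  have one_sided: "mform p N J u \<le> B" if u: "\<forall>j<p. ip N (u j) (u j) \<le> 1" for u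
  proof -
    obtain m :: "nat \<Rightarrow> nat \<Rightarrow> int" where m: "\<forall>j<p. \<forall>i. \<bar>h * m j i - u j i\<bar> \<le> h"
      "mform p N J u \<le> mform p N J (\<lambda>j. if j < p then (\<lambda>i. h * m j i) else u j)"
      using multilinear_rounding[OF h order_refl, of p u N J]
      by (elim exE conjE) (rule that)
    \<comment> \<open>The restrictions make \<open>m'\<close> extensional, as \<open>grid\<close>
      and \<open>PiE\<close> demand; the form reads only the retained entries.\<close>
    define m' where "m' = restrict (\<lambda>j. restrict (m j) {..<N}) {..<p}"
    have "m' \<in> PiE {..<p} (\<lambda>_. grid N (N * (p + 1)\<^sup>2))"
    proof (unfold m'_def restrict_PiE_iff, intro ballI)
      fix j assume j: "j \<in> {..<p}"
      then have u1: "ip N (u j) (u j) \<le> 1" using u by simp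
      show "restrict (m j) {..<N} \<in> grid N (N * (p + 1)\<^sup>2)"
        by (rule rounding_in_grid[OF N p u1]) (use m(1) j in \<open>simp add: h_def\<close>)
    qed
    then have "mform p N J (\<lambda>j i. h * m' j i) \<le> B" using B by (simp add: h_def)
    moreover have "mform p N J (\<lambda>j i. h * m' j i) = mform p N J (\<lambda>j. if j < p then (\<lambda>i. h * m j i) else u j)"
      by (rule mform_cong) (auto simp: m'_def)
    ultimately show ?thesis using m(2) by linarith
  qed
  show ?thesis unfolding unit_bounded_def
  proof (intro allI impI)
    fix a :: "nat \<Rightarrow> nat \<Rightarrow> real" assume a: "\<forall>j<p. ip N (a j) (a j) \<le> 1"
    \<comment> \<open>Flipping the sign of one slot turns the one-sided bound into a bound on the
      absolute value.\<close>
    have "mform p N J (a(0 := (\<lambda>i. - a 0 i))) \<le> B"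
      by (rule one_sided) (use a in \<open>auto simp: ip_def\<close>)
    then have "- mform p N J a \<le> B" using mform_neg_slot[of 0 p N J a] p by simp
    then show "\<bar>mform p N J a\<bar> \<le> B" using one_sided[OF a] by linarith
  qed
qed

text \<open>The variance is the product of the squared norms of the slots, each at most
  \<open>(1 + 1/p)\<^sup>2\<close>, and \<open>(1 + 1/p) ^ p\<close> is at most
  \<open>exp 1\<close>.\<close>

lemma grid_variance_le:
  assumes N: "N \<ge> 1" and p: "p \<ge> 1" and m: "m \<in> PiE {..<p} (\<lambda>_. grid N (N * (p + 1)\<^sup>2))"
  shows "(\<Sum>is\<in>idx p N. (\<Prod>j<p. 1 / (real p * sqrt N) * m j (is ! j))\<^sup>2) \<le> 9"
proof -
  define h where "h = 1 / (real p * sqrt N)"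
  have h2: "h\<^sup>2 = 1 / (real p ^ 2 * N)" by (simp add: h_def power_divide power_mult_distrib)
  have "(\<Sum>i<N. (h * m j i)\<^sup>2) \<le> (1 + 1 / real p)\<^sup>2" if "j < p" for j
  proof -
    have "m j \<in> grid N (N * (p + 1)\<^sup>2)" using m that by auto
    then have "real_of_int (\<Sum>i<N. (m j i)\<^sup>2) \<le> real_of_int (int (N * (p + 1)\<^sup>2))"
      unfolding of_int_le_iff by (simp add: grid_def)
    then have s: "(\<Sum>i<N. (real_of_int (m j i))\<^sup>2) \<le> N * (real p + 1)\<^sup>2" by (simp add: add.commute)
    have "(\<Sum>i<N. (h * m j i)\<^sup>2) = h\<^sup>2 * (\<Sum>i<N. (real_of_int (m j i))\<^sup>2)"
      by (simp add: sum_distrib_left power_mult_distrib)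
    also have "\<dots> \<le> h\<^sup>2 * (N * (real p + 1)\<^sup>2)" by (rule mult_left_mono[OF s]) simp
    also have "\<dots> = (1 + 1 / real p)\<^sup>2"
      using N p unfolding h2 by (simp add: power2_eq_square field_simps)
    finally show ?thesis .
  qed
  then have "(\<Prod>j<p. \<Sum>i<N. (h * m j i)\<^sup>2) \<le> (\<Prod>j<p. (1 + 1 / real p)\<^sup>2)"
    by (intro prod_mono) (auto intro!: sum_nonneg)
  also have "\<dots> = ((1 + 1 / real p) ^ p)\<^sup>2" by (simp add: power_mult[symmetric] mult.commute)
  also have "\<dots> \<le> 3\<^sup>2"
  proof (rule power_mono)
    show "(1 + 1 / real p) ^ p \<le> 3"
      using exp_ge_one_plus_x_over_n_power_n[of p 1] p exp_le by linarith
  qed simp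
  finally show ?thesis
    unfolding h_def[symmetric] prod_power_distrib sum_idx_prod[of "\<lambda>j i. (h * m j i)\<^sup>2"] by simp
qed

text \<open>The exceptional event is a finite union of half-spaces indexed by tuples of grid points,
  hence measurable without reference to the supremum of the form.\<close>

lemma unit_bounded_tail:
  assumes N: "N \<ge> 1" and p: "p \<ge> 1"
  shows "\<exists>E \<in> sets (disorder p N). measure (disorder p N) E \<le> exp (- real N) \<and>
           (\<forall>J \<in> space (disorder p N) - E. unit_bounded p N J (12 * real p ^ 2 * sqrt N))"
proof -
  define R where "R = N * (p + 1)\<^sup>2"
  define S where "S = PiE {..<p} (\<lambda>_. grid N R)"
  \<comment> \<open>With variance bound 9 the exponent is
    \<open>B\<^sup>2 / 18 = 8 * p ^ 4 * N\<close>, enough to beat the cardinality of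
    \<open>S\<close> and leave \<open>exp (- N)\<close>.\<close>
  define B where "B = 12 * real p ^ 2 * sqrt N"
  define z where "z m is = (\<Prod>j<p. 1 / (real p * sqrt N) * real_of_int (m j (is ! j)))" for m :: "nat \<Rightarrow> nat \<Rightarrow> int" and "is"
  define E where "E m = {J \<in> space (disorder p N). (\<Sum>is\<in>idx p N. J is * z m is) \<ge> B}" for m
  have finS: "finite S" unfolding S_def by (intro finite_PiE finite_grid) auto
  have Em: "E m \<in> sets (disorder p N)" for m
    unfolding E_def disorder_def by measurable
  have tail: "measure (disorder p N) (E m) \<le> exp (- B\<^sup>2 / 18)" if "m \<in> S" for m
    using gaussian_linear_tail[of "idx p N" "z m" 9 B] grid_variance_le[OF N p, of m] that
    by (simp add: E_def disorder_def B_def S_def R_def z_def)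
  interpret prob_space "disorder p N" unfolding disorder_def by (rule prob_space_gaussian_product)
  have "real (card S) = real (card (grid N R)) ^ p" by (simp add: S_def card_PiE)
  also have "\<dots> \<le> (2 ^ R * 3 ^ N) ^ p" by (intro power_mono card_grid_le) simp
  also have "\<dots> \<le> (exp (real R) * exp (2 * real N)) ^ p"
  proof -
    have e: "(2::real) \<le> exp 1" using exp_ge_add_one_self[of "1::real"] by simp
    have e3: "(3::real) \<le> exp 2" using exp_ge_add_one_self[of "2::real"] by simp
    have "(2::real) ^ R \<le> exp 1 ^ R" "(3::real) ^ N \<le> exp 2 ^ N"
      by (intro power_mono e e3; simp)+
    then show ?thesis by (intro power_mono mult_mono) (auto simp: exp_of_nat_mult[symmetric] mult.commute)
  qed
  also have "\<dots> = exp (real p * (real R + 2 * real N))"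
    by (simp add: exp_add[symmetric] exp_of_nat_mult[symmetric])
  finally have card: "real (card S) \<le> exp (real p * (real R + 2 * real N))" .
  have "measure (disorder p N) (\<Union>m\<in>S. E m) \<le> (\<Sum>m\<in>S. measure (disorder p N) (E m))"
    by (rule finite_measure_subadditive_finite[OF finS]) (use Em in auto)
  also have "\<dots> \<le> (\<Sum>m\<in>S. exp (- B\<^sup>2 / 18))" by (intro sum_mono tail)
  also have "\<dots> \<le> exp (real p * (real R + 2 * real N)) * exp (- B\<^sup>2 / 18)"
    using card by (simp add: mult_right_mono)
  also have "\<dots> = exp (real p * (real R + 2 * real N) - B\<^sup>2 / 18)" by (simp add: exp_add[symmetric])
  also have "\<dots> \<le> exp (- real N)"
  proof -
    define q where "q = real p"
    have q: "q \<ge> 1" using p by (simp add: q_def)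
    have q2: "q \<le> q ^ 2" "q ^ 2 \<le> q ^ 3" "q ^ 3 \<le> q ^ 4" "1 \<le> q ^ 4" "q \<le> q^3"
      using q power_increasing[of 1 2 q] power_increasing[of 2 3 q] power_increasing[of 3 4 q]
        power_increasing[of 0 4 q] power_increasing[of 1 3 q] by auto
    have "q * ((q + 1)\<^sup>2 + 2) + 1 = q ^ 3 + 2 * q ^ 2 + 3 * q + 1"
      by (simp add: power2_eq_square power3_eq_cube algebra_simps)
    \<comment> \<open>The coefficients sum to 7, and every power is at most \<open>q ^ 4\<close>
      since \<open>q \<ge> 1\<close>.\<close>
    also have "\<dots> \<le> 8 * q ^ 4" using q2 by linarith
    finally have "real N * (q * ((q + 1)\<^sup>2 + 2) + 1) \<le> real N * (8 * q ^ 4)"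
      by (rule mult_left_mono) simp
    moreover have "B\<^sup>2 / 18 = real N * (8 * q ^ 4)"
      by (simp add: B_def q_def power_mult_distrib)
    moreover have "real p * (real R + 2 * real N) + real N = real N * (q * ((q + 1)\<^sup>2 + 2) + 1)"
      by (simp add: R_def q_def algebra_simps)
    ultimately show ?thesis by simp
  qed
  finally have "measure (disorder p N) (\<Union>m\<in>S. E m) \<le> exp (- real N)" .
  moreover have "unit_bounded p N J B" if "J \<in> space (disorder p N) - (\<Union>m\<in>S. E m)" for J
  proof (rule unit_bounded_from_grid[OF N p], intro ballI)
    fix m assume "m \<in> PiE {..<p} (\<lambda>_. grid N (N * (p + 1)\<^sup>2))"
    then have "J \<notin> E m" using that by (auto simp: S_def R_def)
    then show "mform p N J (\<lambda>j i. 1 / (real p * sqrt N) * m j i) \<le> B"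
      using that by (auto simp: E_def mform_def z_def)
  qed
  moreover have "(\<Union>m\<in>S. E m) \<in> sets (disorder p N)" using Em finS by auto
  ultimately show ?thesis by (auto simp: B_def)
qed

section \<open>Covariant derivatives of homogeneous polynomials\<close>

lemma ip_add_scale_left: "ip N (\<lambda>i. a i + c * b i) z = ip N a z + c * ip N b z"
  by (simp add: ip_def sum.distrib sum_distrib_left algebra_simps)

lemma ip_scale_left: "ip N (\<lambda>i. c * b i) z = c * ip N b z"
  by (simp add: ip_def sum_distrib_left algebra_simps)

lemma ip_scale_right: "ip N z (\<lambda>i. c * b i) = c * ip N z b"
  by (simp add: ip_def sum_distrib_left algebra_simps)

lemma mform_slot_scale:
  assumes "j < p"
  shows "mform p N J (a(j := (\<lambda>i. c * v i))) = c * mform p N J (a(j := v))"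
proof -
  have "mform p N J (a(j := (\<lambda>i. c * v i))) = ip N (\<lambda>i. mform p N J (a(j := basis_vec i))) (\<lambda>i. c * v i)"
    by (rule mform_slot_linear[OF assms])
  also have "\<dots> = c * ip N (\<lambda>i. mform p N J (a(j := basis_vec i))) v" by (rule ip_scale_right)
  also have "ip N (\<lambda>i. mform p N J (a(j := basis_vec i))) v = mform p N J (a(j := v))"
    by (rule mform_slot_linear[OF assms, symmetric])
  finally show ?thesis .
qed

lemma ip_add_scale_right: "ip N z (\<lambda>i. a i + c * b i) = ip N z a + c * ip N z b"
  using ip_add_scale_left[of N a c b z] by (simp add: ip_commute)

text \<open>Cauchy--Schwarz on the unit ball, from the nonnegativity of the squared norms of
  \<open>v + w\<close> and \<open>v - w\<close>.\<close>

lemma abs_ip_le_1: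
  assumes "ip N v v \<le> 1" "ip N w w \<le> 1"
  shows "\<bar>ip N v w\<bar> \<le> 1"
proof -
  have "ip N (\<lambda>i. v i + c * w i) (\<lambda>i. v i + c * w i) = ip N v v + 2 * c * ip N v w + c\<^sup>2 * ip N w w" for c
    by (simp add: ip_add_scale_left ip_add_scale_right ip_commute[of N w v] power2_eq_square algebra_simps)
  then have "0 \<le> ip N v v + 2 * c * ip N v w + c\<^sup>2 * ip N w w" for c
    by (metis ip_nonneg)
  from this[of 1] this[of "-1"] show ?thesis using assms by simp
qed

text \<open>Support in the first \<open>N\<close> coordinates is included so that
  \<open>proj\<close> fixes tangent vectors as functions.\<close>

definition tangent :: "nat \<Rightarrow> (nat \<Rightarrow> real) \<Rightarrow> (nat \<Rightarrow> real) \<Rightarrow> bool" where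
  "tangent N x v \<longleftrightarrow> (\<forall>i\<ge>N. v i = 0) \<and> ip N x v = 0"

lemma proj_tangent: "tangent N x v \<Longrightarrow> proj N x v = v"
  by (auto simp: tangent_def proj_def)

lemma ip_proj_right:
  "ip N z (proj N x v) = ip N z v - ip N x v / ip N x x * ip N z x"
proof -
  have "ip N z (proj N x v) = ip N z (\<lambda>i. v i + (- (ip N x v / ip N x x)) * x i)"
    by (rule ip_cong) (auto simp: proj_def)
  also have "\<dots> = ip N z v + (- (ip N x v / ip N x x)) * ip N z x" by (rule ip_add_scale_right)
  finally show ?thesis by simp
qed

lemma tangent_proj: "ip N x x > 0 \<Longrightarrow> tangent N x (proj N x v)"
  by (simp add: tangent_def ip_proj_right) (simp add: proj_def)

lemma ip_proj_proj:
  assumes "ip N x x > 0"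
  shows "ip N (proj N x v) (proj N x w) = ip N v w - ip N x v * ip N x w / ip N x x"
proof -
  have "ip N (proj N x v) (proj N x w) = ip N (proj N x v) w"
    using assms tangent_proj[OF assms, of v] by (simp add: ip_proj_right tangent_def ip_commute)
  also have "\<dots> = ip N w (proj N x v)" by (rule ip_commute)
  finally show ?thesis by (simp add: ip_proj_right ip_commute)
qed

text \<open>A monomial \<open>(ps, \<sigma>)\<close> in a point \<open>x\<close> and tangent vectors \<open>vs\<close> stands for
  \<open>\<Prod>(a,b)\<in>ps. (- \<langle>vs a, vs b\<rangle> / \<bar>x\<bar>\<^sup>2)\<close> times the multilinear form with slot \<open>j\<close> filled by entry \<open>\<sigma> j\<close>
  of \<open>x # vs\<close>. Along the curve \<open>x + t u\<close> the projected tangent vector \<open>v\<close> moves with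
  velocity \<open>- \<langle>u, v\<rangle> / \<bar>x\<bar>\<^sup>2 x\<close>, and the inner products and \<open>\<bar>x\<bar>\<^sup>2\<close> are stationary at \<open>t = 0\<close>,
  so the derivative only acts on the slots.\<close>

type_synonym monomial = "(nat \<times> nat) list \<times> (nat \<Rightarrow> nat)"

definition pairs_val :: "nat \<Rightarrow> (nat \<Rightarrow> real) \<Rightarrow> (nat \<Rightarrow> real) list \<Rightarrow> (nat \<times> nat) list \<Rightarrow> real" where
  "pairs_val N x vs ps = prod_list (map (\<lambda>(a, b). - ip N (vs ! a) (vs ! b) / ip N x x) ps)"

definition slot_vec :: "(nat \<Rightarrow> real) \<Rightarrow> (nat \<Rightarrow> real) list \<Rightarrow> (nat \<Rightarrow> nat) \<Rightarrow> nat \<Rightarrow> nat \<Rightarrow> real" where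
  "slot_vec x vs \<sigma> = (\<lambda>j. (x # vs) ! \<sigma> j)"

definition monomial_val ::
  "nat \<Rightarrow> nat \<Rightarrow> (nat list \<Rightarrow> real) \<Rightarrow> (nat \<Rightarrow> real) \<Rightarrow> (nat \<Rightarrow> real) list \<Rightarrow> monomial \<Rightarrow> real" where
  "monomial_val p N J x vs m = pairs_val N x vs (fst m) * mform p N J (slot_vec x vs (snd m))"

text \<open>Prepending a direction to the list of tangent vectors shifts their positions by one. In
  \<open>x # vs\<close> entry 0 stays the base point; pairs index \<open>vs\<close> itself, so there
  every index shifts.\<close>

definition lift_slots :: "(nat \<Rightarrow> nat) \<Rightarrow> nat \<Rightarrow> nat" where
  "lift_slots \<sigma> = (\<lambda>j. if \<sigma> j = 0 then 0 else Suc (\<sigma> j))"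

definition lift_pairs :: "(nat \<times> nat) list \<Rightarrow> (nat \<times> nat) list" where
  "lift_pairs = map (\<lambda>(a, b). (Suc a, Suc b))"

text \<open>A slot holding \<open>x\<close> receives the new direction, entry 1 of
  \<open>x # v # vs\<close>. A slot holding a tangent vector falls back to \<open>x\<close> and
  leaves a pair; its entry \<open>\<sigma> j\<close> in \<open>x # vs\<close> has the same index in
  \<open>v # vs\<close>, which explains the unshifted \<open>\<sigma> j\<close>.\<close>

definition diff_slot :: "monomial \<Rightarrow> nat \<Rightarrow> monomial" where
  "diff_slot m j = (case m of (ps, \<sigma>) \<Rightarrow>
     if \<sigma> j = 0 then (lift_pairs ps, (lift_slots \<sigma>)(j := 1))
     else ((0, \<sigma> j) # lift_pairs ps, (lift_slots \<sigma>)(j := 0)))"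

primrec monomials :: "nat \<Rightarrow> nat \<Rightarrow> monomial list" where
  "monomials p 0 = [([], \<lambda>_. 0)]"
| "monomials p (Suc l) = concat (map (\<lambda>m. map (diff_slot m) [0..<p]) (monomials p l))"

text \<open>The counting identity records homogeneity: slots holding \<open>x\<close> minus twice
  the number of pairs equals \<open>p - l\<close>, the degree in \<open>x\<close> of an
  \<open>l\<close>-th derivative.\<close>

definition wf_monomial :: "nat \<Rightarrow> nat \<Rightarrow> monomial \<Rightarrow> bool" where
  "wf_monomial p l m \<longleftrightarrow> (\<forall>(a, b)\<in>set (fst m). a < l \<and> b < l) \<and> (\<forall>j<p. snd m j \<le> l) \<and>
     card {j. j < p \<and> snd m j = 0} + l = p + 2 * length (fst m)"

text \<open>One derivative either removes a slot holding \<open>x\<close>, or adds such a slot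
  together with one pair; both changes preserve the counting identity.\<close>

lemma wf_diff_slot:
  assumes "wf_monomial p l m" "j < p"
  shows "wf_monomial p (Suc l) (diff_slot m j)"
proof -
  obtain ps \<sigma> where m: "m = (ps, \<sigma>)" by (cases m)
  let ?Z = "{k. k < p \<and> \<sigma> k = 0}"
  have fin: "finite ?Z" by simp
  have idx: "\<forall>(a, b)\<in>set (lift_pairs ps). a < Suc l \<and> b < Suc l" "\<forall>k<p. \<sigma> k \<le> l"
    and c: "card ?Z + l = p + 2 * length ps"
    using assms(1) by (auto simp: wf_monomial_def m lift_pairs_def)
  show ?thesis
  proof (cases "\<sigma> j = 0")
    case True
    then have "j \<in> ?Z" using assms(2) by simp
    then have "card ?Z = Suc (card (?Z - {j}))" using card.remove[OF fin] by blast
    moreover have "{k. k < p \<and> ((lift_slots \<sigma>)(j := 1)) k = 0} = ?Z - {j}"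
      by (auto simp: lift_slots_def split: if_splits)
    ultimately show ?thesis using idx c True
      by (auto simp: wf_monomial_def m diff_slot_def lift_slots_def lift_pairs_def)
  next
    case False
    then have "card (insert j ?Z) = Suc (card ?Z)" by simp
    moreover have "{k. k < p \<and> ((lift_slots \<sigma>)(j := 0)) k = 0} = insert j ?Z"
      using assms(2) by (auto simp: lift_slots_def split: if_splits)
    ultimately show ?thesis using idx c False assms(2)
      by (auto simp: wf_monomial_def m diff_slot_def lift_slots_def lift_pairs_def less_Suc_eq_le)
  qed
qed

lemma wf_monomials: "m \<in> set (monomials p l) \<Longrightarrow> wf_monomial p l m"
proof (induction l arbitrary: m)
  case 0
  then show ?case by (auto simp: wf_monomial_def)
next
  case (Suc l)
  then show ?case by (auto intro!: wf_diff_slot)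
qed

lemma sum_list_concat_upt:
  fixes f :: "'b \<Rightarrow> real"
  shows "sum_list (map f (concat (map (\<lambda>m. map (g m) [0..<p]) ms))) = (\<Sum>m\<leftarrow>ms. \<Sum>j<p. f (g m j))"
  by (induction ms) (simp_all add: o_def interv_sum_list_conv_sum_set_nat atLeast0LessThan)

lemma length_monomials: "length (monomials p l) = p ^ l"
  by (induction l) (simp_all add: length_concat o_def sum_list_triv)

lemma slot_vec_lift:
  "slot_vec x (v # vs) ((lift_slots \<sigma>)(j := k)) = (slot_vec x vs \<sigma>)(j := (x # v # vs) ! k)"
  by (auto simp: slot_vec_def lift_slots_def fun_eq_iff nth_Cons split: nat.splits)

lemma pairs_val_lift: "pairs_val N x (v # vs) (lift_pairs ps) = pairs_val N x vs ps"
  by (induction ps) (auto simp: pairs_val_def lift_pairs_def)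

text \<open>The new pair is the scalar coefficient of \<open>x\<close> in the velocity of the
  projected vector; slot linearity moves it inside, so \<open>diff_slot\<close> just inserts the
  velocity into slot \<open>j\<close>.\<close>

lemma monomial_val_diff_slot:
  assumes "j < p"
  shows "monomial_val p N J x (v # vs) (diff_slot (ps, \<sigma>) j) =
    pairs_val N x vs ps * mform p N J ((slot_vec x vs \<sigma>)
      (j := if \<sigma> j = 0 then v else (\<lambda>i. - ip N v (vs ! (\<sigma> j - 1)) / ip N x x * x i)))"
proof (cases "\<sigma> j = 0")
  case True
  then show ?thesis
    by (simp add: monomial_val_def diff_slot_def slot_vec_lift pairs_val_lift)
next
  case False
  have pv: "pairs_val N x (v # vs) ((0, \<sigma> j) # lift_pairs ps)
      = - ip N v (vs ! (\<sigma> j - 1)) / ip N x x * pairs_val N x vs ps"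
    using False pairs_val_lift[of N x v vs ps] by (simp add: pairs_val_def nth_Cons')
  have d: "diff_slot (ps, \<sigma>) j = ((0, \<sigma> j) # lift_pairs ps, (lift_slots \<sigma>)(j := 0))"
    using False by (simp add: diff_slot_def)
  have "monomial_val p N J x (v # vs) (diff_slot (ps, \<sigma>) j)
      = - ip N v (vs ! (\<sigma> j - 1)) / ip N x x * pairs_val N x vs ps * mform p N J ((slot_vec x vs \<sigma>)(j := x))"
    unfolding monomial_val_def d fst_conv snd_conv pv slot_vec_lift by simp
  then show ?thesis unfolding if_not_P[OF False] mform_slot_scale[OF assms] by (simp only: mult_ac)
qed

lemma ip_curve:
  assumes "tangent N x u"
  shows "ip N (\<lambda>i. x i + t * u i) (\<lambda>i. x i + t * u i) = ip N x x + t\<^sup>2 * ip N u u"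
  using assms by (simp add: ip_add_scale_left ip_add_scale_right tangent_def ip_commute[of N u x]
      power2_eq_square)

lemma ip_curve_tangent:
  assumes "tangent N x v"
  shows "ip N (\<lambda>i. x i + t * u i) v = t * ip N u v"
  using assms by (simp add: ip_add_scale_left tangent_def)

lemma DERIV_proj_curve:
  assumes x: "ip N x x > 0" and u: "tangent N x u" and v: "tangent N x v" and i: "i < N"
  shows "((\<lambda>t. proj N (\<lambda>i. x i + t * u i) v i) has_field_derivative - ip N u v / ip N x x * x i) (at 0)"
proof -
  have "(\<lambda>t. proj N (\<lambda>i. x i + t * u i) v i)
      = (\<lambda>t. v i - t * ip N u v / (ip N x x + t\<^sup>2 * ip N u u) * (x i + t * u i))"
    using i by (simp add: proj_def ip_curve[OF u] ip_curve_tangent[OF v])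
  then show ?thesis using x
    by (auto intro!: derivative_eq_intros simp: field_simps power2_eq_square)
qed

text \<open>Tangency removes all linear terms in \<open>t\<close>: the expression depends on
  \<open>t\<close> only through its square.\<close>

lemma DERIV_pair_curve:
  assumes x: "ip N x x > 0" and u: "tangent N x u" and v: "tangent N x v" and w: "tangent N x w"
  shows "((\<lambda>t. - ip N (proj N (\<lambda>i. x i + t * u i) v) (proj N (\<lambda>i. x i + t * u i) w)
      / ip N (\<lambda>i. x i + t * u i) (\<lambda>i. x i + t * u i)) has_field_derivative 0) (at 0)"
proof -
  have pos: "ip N x x + t\<^sup>2 * ip N u u > 0" for t
    using x by (intro add_pos_nonneg) auto
  have "(\<lambda>t. - ip N (proj N (\<lambda>i. x i + t * u i) v) (proj N (\<lambda>i. x i + t * u i) w)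
      / ip N (\<lambda>i. x i + t * u i) (\<lambda>i. x i + t * u i))
    = (\<lambda>t. - (ip N v w - (t * ip N u v) * (t * ip N u w) / (ip N x x + t\<^sup>2 * ip N u u))
        / (ip N x x + t\<^sup>2 * ip N u u))"
    using pos by (simp add: ip_proj_proj ip_curve[OF u] ip_curve_tangent[OF v] ip_curve_tangent[OF w])
  then show ?thesis using x
    by (auto intro!: derivative_eq_intros)
qed

lemma map_proj_tangent: "\<forall>v\<in>set vs. tangent N x v \<Longrightarrow> map (proj N x) vs = vs"
  by (simp add: map_idI proj_tangent)

lemma DERIV_pairs_val_curve:
  assumes x: "ip N x x > 0" and u: "tangent N x u" and vs: "\<forall>v\<in>set vs. tangent N x v"
    and ps: "\<forall>(a, b)\<in>set ps. a < length vs \<and> b < length vs"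
  shows "((\<lambda>t. pairs_val N (\<lambda>i. x i + t * u i) (map (proj N (\<lambda>i. x i + t * u i)) vs) ps)
    has_field_derivative 0) (at 0)"
  using ps
proof (induction ps)
  case Nil
  then show ?case by (simp add: pairs_val_def)
next
  case (Cons q ps)
  obtain a b where q: "q = (a, b)" by (cases q)
  have ab: "a < length vs" "b < length vs" using Cons.prems by (auto simp: q)
  have "((\<lambda>t. - ip N (proj N (\<lambda>i. x i + t * u i) (vs ! a)) (proj N (\<lambda>i. x i + t * u i) (vs ! b))
      / ip N (\<lambda>i. x i + t * u i) (\<lambda>i. x i + t * u i)) has_field_derivative 0) (at 0)"
    by (rule DERIV_pair_curve[OF x u]) (use vs ab in auto)
  moreover have "((\<lambda>t. pairs_val N (\<lambda>i. x i + t * u i) (map (proj N (\<lambda>i. x i + t * u i)) vs) ps)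
    has_field_derivative 0) (at 0)"
    using Cons by auto
  ultimately show ?case using DERIV_mult ab by (fastforce simp: pairs_val_def q)
qed

lemma DERIV_monomial_val_curve:
  assumes x: "ip N x x > 0" and u: "tangent N x u" and vs: "\<forall>v\<in>set vs. tangent N x v"
    and m: "wf_monomial p (length vs) m"
  shows "((\<lambda>t. monomial_val p N J (\<lambda>i. x i + t * u i) (map (proj N (\<lambda>i. x i + t * u i)) vs) m)
    has_field_derivative (\<Sum>j<p. monomial_val p N J x (u # vs) (diff_slot m j))) (at 0)"
proof -
  obtain ps \<sigma> where m_eq: "m = (ps, \<sigma>)" by (cases m)
  have ps: "\<forall>(a, b)\<in>set ps. a < length vs \<and> b < length vs" and \<sigma>: "\<And>j. j < p \<Longrightarrow> \<sigma> j \<le> length vs"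
    using m by (auto simp: wf_monomial_def m_eq)
  let ?y = "\<lambda>t i. x i + t * u i"
  let ?a = "\<lambda>t. slot_vec (?y t) (map (proj N (?y t)) vs) \<sigma>"
  define a' where "a' j = (if \<sigma> j = 0 then u else (\<lambda>i. - ip N u (vs ! (\<sigma> j - 1)) / ip N x x * x i))" for j
  have a0: "?a 0 = slot_vec x vs \<sigma>"
    using vs by (simp add: map_proj_tangent)
  have slots: "((\<lambda>t. ?a t j i) has_field_derivative a' j i) (at 0)" if "j < p" "i < N" for j i
  proof (cases "\<sigma> j")
    case 0
    then show ?thesis by (auto simp: slot_vec_def a'_def intro!: derivative_eq_intros)
  next
    case (Suc k)
    then have "k < length vs" using \<sigma>[OF that(1)] by simp
    then show ?thesis
      using DERIV_proj_curve[OF x u _ that(2), of "vs ! k"] vs Suc by (simp add: slot_vec_def a'_def)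
  qed
  have "((\<lambda>t. pairs_val N (?y t) (map (proj N (?y t)) vs) ps * mform p N J (?a t))
      has_field_derivative
      0 * mform p N J (?a 0) + (\<Sum>j<p. mform p N J ((?a 0)(j := a' j))) * pairs_val N (?y 0) (map (proj N (?y 0)) vs) ps) (at 0)"
    by (rule DERIV_mult[OF DERIV_pairs_val_curve[OF x u vs ps] has_field_derivative_mform[OF slots]])
  moreover have "pairs_val N (?y 0) (map (proj N (?y 0)) vs) ps = pairs_val N x vs ps"
    using vs by (simp add: map_proj_tangent)
  moreover have "(\<Sum>j<p. monomial_val p N J x (u # vs) (diff_slot m j))
      = (\<Sum>j<p. mform p N J ((slot_vec x vs \<sigma>)(j := a' j))) * pairs_val N x vs ps"
    unfolding m_eq sum_distrib_right a'_def
    by (intro sum.cong refl) (simp only: monomial_val_diff_slot lessThan_iff mult.commute)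
  ultimately show ?thesis
    unfolding a0 m_eq monomial_val_def fst_conv snd_conv by (simp only: mult_zero_left add_0)
qed

section \<open>Closed form and size of the covariant derivatives\<close>

definition covd_form :: "nat \<Rightarrow> nat \<Rightarrow> (nat list \<Rightarrow> real) \<Rightarrow> nat \<Rightarrow> (nat \<Rightarrow> real) \<Rightarrow> (nat \<Rightarrow> real) list \<Rightarrow> real" where
  "covd_form p N J l x vs = (\<Sum>m\<leftarrow>monomials p l. monomial_val p N J x vs m)"

lemma DERIV_sum_list:
  assumes "\<And>m. m \<in> set ms \<Longrightarrow> ((\<lambda>t. f m t) has_field_derivative f' m) (at z)"
  shows "((\<lambda>t. \<Sum>m\<leftarrow>ms. f m t) has_field_derivative (\<Sum>m\<leftarrow>ms. f' m)) (at (z::real))"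
  using assms by (induction ms) (auto intro!: DERIV_add)

lemma covd_form_Suc:
  "covd_form p N J (Suc l) x vs = (\<Sum>m\<leftarrow>monomials p l. \<Sum>j<p. monomial_val p N J x vs (diff_slot m j))"
  by (simp only: covd_form_def monomials.simps sum_list_concat_upt)

text \<open>The claim is proved at all nonzero points and not just on the sphere, because the
  straight curve \<open>x + t * v\<close> leaves the sphere for nonzero \<open>t\<close> and
  \<open>v\<close>. Its squared norm never drops below that of \<open>x\<close>, so the induction
  hypothesis applies along the whole curve.\<close>

lemma covd_mform:
  assumes "ip N x x > 0" "\<forall>v\<in>set vs. tangent N x v" "length vs = l"
  shows "covd l N (\<lambda>x. mform p N J (\<lambda>_. x)) x vs = covd_form p N J l x vs"
  using assms
proof (induction l arbitrary: x vs)
  case 0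
  then show ?case by (simp add: covd_form_def monomial_val_def pairs_val_def slot_vec_def)
next
  case (Suc l)
  then obtain v ws where vs: "vs = v # ws" and v: "tangent N x v" and ws: "\<forall>w\<in>set ws. tangent N x w"
    and l: "length ws = l" by (cases vs) auto
  have "covd l N (\<lambda>x. mform p N J (\<lambda>_. x)) (\<lambda>i. x i + t * v i) (map (proj N (\<lambda>i. x i + t * v i)) ws)
      = covd_form p N J l (\<lambda>i. x i + t * v i) (map (proj N (\<lambda>i. x i + t * v i)) ws)" for t
  proof (rule Suc.IH)
    show pos: "ip N (\<lambda>i. x i + t * v i) (\<lambda>i. x i + t * v i) > 0"
      unfolding ip_curve[OF v] using Suc.prems(1) by (intro add_pos_nonneg) auto
    show "\<forall>w\<in>set (map (proj N (\<lambda>i. x i + t * v i)) ws). tangent N (\<lambda>i. x i + t * v i) w"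
      using tangent_proj[OF pos] by auto
  qed (simp add: l)
  then have "covd (Suc l) N (\<lambda>x. mform p N J (\<lambda>_. x)) x vs
     = deriv (\<lambda>t. covd_form p N J l (\<lambda>i. x i + t * v i) (map (proj N (\<lambda>i. x i + t * v i)) ws)) 0"
    by (simp add: vs proj_tangent[OF v])
  also have "\<dots> = covd_form p N J (Suc l) x vs"
    unfolding covd_form_Suc vs unfolding covd_form_def
    by (intro DERIV_imp_deriv DERIV_sum_list DERIV_monomial_val_curve Suc.prems(1) v ws)
       (simp add: l wf_monomials)
  finally show ?case .
qed

text \<open>The latest direction occurs exactly once in each monomial, in a slot or in the new pair.
  Hence the form is given by an inner product with a fixed vector.\<close>

lemma covd_form_head_linear: "\<exists>g. \<forall>v. covd_form p N J (Suc l) x (v # vs) = ip N g v"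
proof -
  have slot: "\<exists>g. \<forall>v. monomial_val p N J x (v # vs) (diff_slot m j) = ip N g v" if j: "j < p" for m j
  proof -
    obtain ps \<sigma> where m: "m = (ps, \<sigma>)" by (cases m)
    let ?C = "pairs_val N x vs ps" and ?a = "slot_vec x vs \<sigma>"
    show ?thesis
    proof (cases "\<sigma> j = 0")
      case True
      have "monomial_val p N J x (v # vs) (diff_slot m j)
          = ip N (\<lambda>i. ?C * mform p N J (?a(j := basis_vec i))) v" for v
        using True by (simp add: m monomial_val_diff_slot[OF j] mform_slot_linear[OF j, of _ _ _ v] ip_scale_left)
      then show ?thesis by blast
    next
      case False
      let ?w = "vs ! (\<sigma> j - 1)"
      have "monomial_val p N J x (v # vs) (diff_slot m j)
          = ip N (\<lambda>i. (- ?C / ip N x x * mform p N J (?a(j := x))) * ?w i) v" for v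
      proof -
        have "mform p N J (?a(j := (\<lambda>i. - ip N v ?w / ip N x x * x i)))
            = - ip N v ?w / ip N x x * mform p N J (?a(j := x))"
          by (rule mform_slot_scale[OF j])
        then show ?thesis using False
          by (simp only: m monomial_val_diff_slot[OF j] if_False ip_scale_left) (simp add: ip_commute)
      qed
      then show ?thesis by blast
    qed
  qed
  have ex_sum: "\<exists>g. \<forall>v. (\<Sum>j<k. F j v) = ip N g v" if "\<And>j. j < k \<Longrightarrow> \<exists>g. \<forall>v. F j v = ip N g v"
    for k :: nat and F :: "nat \<Rightarrow> (nat \<Rightarrow> real) \<Rightarrow> real"
  proof -
    from that obtain g where g: "\<And>j v. j < k \<Longrightarrow> F j v = ip N (g j) v" by metis
    have "(\<Sum>j<k. F j v) = ip N (\<lambda>i. \<Sum>j<k. g j i) v" for v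
      using g by (simp add: ip_def sum_distrib_right sum.swap[of _ "{..<N}"])
    then show ?thesis by blast
  qed
  have "\<exists>g. \<forall>v. (\<Sum>m\<leftarrow>ms. \<Sum>j<p. monomial_val p N J x (v # vs) (diff_slot m j)) = ip N g v" for ms
  proof (induction ms)
    case Nil
    show ?case by (intro exI[of _ "\<lambda>_. 0"]) (simp add: ip_def)
  next
    case (Cons m ms)
    then obtain g where g: "\<forall>v. (\<Sum>m\<leftarrow>ms. \<Sum>j<p. monomial_val p N J x (v # vs) (diff_slot m j)) = ip N g v"
      by blast
    obtain h where h: "\<forall>v. (\<Sum>j<p. monomial_val p N J x (v # vs) (diff_slot m j)) = ip N h v"
      using ex_sum[of p "\<lambda>j v. monomial_val p N J x (v # vs) (diff_slot m j)"] slot by blast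
    show ?case using g h
      by (intro exI[of _ "\<lambda>i. h i + 1 * g i"]) (simp only: ip_add_scale_left list.map sum_list.Cons, simp)
  qed
  then show ?thesis by (simp only: covd_form_Suc)
qed

lemma abs_pairs_val_le:
  assumes "ip N x x > 0" "\<forall>v\<in>set vs. ip N v v \<le> 1" "\<forall>(a, b)\<in>set ps. a < length vs \<and> b < length vs"
  shows "\<bar>pairs_val N x vs ps\<bar> \<le> (1 / ip N x x) ^ length ps"
  using assms(3)
proof (induction ps)
  case (Cons q ps)
  obtain a b where q: "q = (a, b)" by (cases q)
  have "\<bar>ip N (vs ! a) (vs ! b)\<bar> \<le> 1" using Cons.prems assms(2) q by (intro abs_ip_le_1) auto
  then have "\<bar>- ip N (vs ! a) (vs ! b) / ip N x x\<bar> \<le> 1 / ip N x x"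
    using assms(1) by (simp add: abs_divide divide_right_mono)
  moreover have "\<bar>pairs_val N x vs ps\<bar> \<le> (1 / ip N x x) ^ length ps" using Cons by auto
  ultimately have "\<bar>- ip N (vs ! a) (vs ! b) / ip N x x\<bar> * \<bar>pairs_val N x vs ps\<bar>
     \<le> 1 / ip N x x * (1 / ip N x x) ^ length ps"
    using assms(1) by (intro mult_mono) auto
  then show ?case by (simp add: pairs_val_def q abs_mult)
qed (simp add: pairs_val_def)

text \<open>Dividing each slot that holds \<open>x\<close> by its norm \<open>s\<close> puts all
  slots in the unit ball; multilinearity extracts the powers of \<open>s\<close>.\<close>

lemma abs_mform_slot_vec_le:
  assumes B: "unit_bounded p N J B" and s: "s > 0" "ip N x x = s\<^sup>2"
    and vs: "\<forall>v\<in>set vs. ip N v v \<le> 1" and \<sigma>: "\<forall>j<p. \<sigma> j \<le> length vs"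
  shows "\<bar>mform p N J (slot_vec x vs \<sigma>)\<bar> \<le> s ^ card {j. j < p \<and> \<sigma> j = 0} * B"
proof -
  define c where "c j = (if \<sigma> j = 0 then s else 1)" for j
  define b where "b j i = slot_vec x vs \<sigma> j i / c j" for j i
  have c: "c j > 0" for j using s by (simp add: c_def)
  have "slot_vec x vs \<sigma> = (\<lambda>j i. c j * b j i)"
    using c by (simp add: b_def fun_eq_iff less_imp_neq[symmetric])
  then have "mform p N J (slot_vec x vs \<sigma>) = (\<Prod>j<p. c j) * mform p N J b"
    by (simp add: mform_scale)
  also have "(\<Prod>j<p. c j) = s ^ card {j. j < p \<and> \<sigma> j = 0}"
    by (simp add: c_def prod.If_cases lessThan_def Collect_conj_eq[symmetric])
  finally have eq: "mform p N J (slot_vec x vs \<sigma>) = s ^ card {j. j < p \<and> \<sigma> j = 0} * mform p N J b" .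
  have "ip N (b j) (b j) \<le> 1" if "j < p" for j
  proof (cases "\<sigma> j")
    case 0
    then have "b j = (\<lambda>i. 1 / s * x i)" by (simp add: b_def c_def slot_vec_def fun_eq_iff)
    then show ?thesis using s by (simp only: ip_scale_left ip_scale_right) (simp add: power2_eq_square)
  next
    case (Suc k)
    then have "b j = vs ! k" by (simp add: b_def c_def slot_vec_def fun_eq_iff)
    then show ?thesis using vs \<sigma> that Suc by (metis Suc_le_lessD nth_mem)
  qed
  then have "\<bar>mform p N J b\<bar> \<le> B" using B by (simp add: unit_bounded_def)
  then show ?thesis using s by (simp add: eq abs_mult mult_left_mono)
qed

text \<open>By the counting identity each of the \<open>p ^ l\<close> monomials has size at most
  \<open>B\<close> times the \<open>(p - l)\<close>-th power of \<open>s\<close>. The factor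
  \<open>s ^ l\<close> on the left avoids truncated subtraction when \<open>l > p\<close>.\<close>

lemma abs_covd_form_le:
  assumes B: "unit_bounded p N J B" "B \<ge> 0" and s: "s > 0" "ip N x x = s\<^sup>2"
    and vs: "\<forall>v\<in>set vs. ip N v v \<le> 1" "length vs = l"
  shows "\<bar>covd_form p N J l x vs\<bar> * s ^ l \<le> real p ^ l * (B * s ^ p)"
proof -
  have mono: "\<bar>monomial_val p N J x vs m\<bar> \<le> B * s ^ p / s ^ l" if "m \<in> set (monomials p l)" for m
  proof -
    let ?Z = "card {j. j < p \<and> snd m j = 0}" and ?n = "length (fst m)"
    have wf: "wf_monomial p l m" by (rule wf_monomials[OF that])
    then have Z: "?Z + l = p + 2 * ?n" by (simp add: wf_monomial_def)
    have "\<bar>monomial_val p N J x vs m\<bar> \<le> (1 / s\<^sup>2) ^ ?n * (s ^ ?Z * B)"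
      unfolding monomial_val_def abs_mult
      using abs_pairs_val_le[of N x vs "fst m"] abs_mform_slot_vec_le[OF B(1) s vs(1), of "snd m"] wf s vs
      by (intro mult_mono) (auto simp: wf_monomial_def)
    also have "\<dots> = B * (s ^ (?Z + l) * (1 / s\<^sup>2) ^ ?n) / s ^ l"
      using s by (simp add: power_add)
    also have "s ^ (?Z + l) * (1 / s\<^sup>2) ^ ?n = s ^ p"
      unfolding Z using s by (simp add: power_add power_mult power_one_over)
    finally show ?thesis .
  qed
  have "\<bar>covd_form p N J l x vs\<bar> \<le> (\<Sum>m\<leftarrow>monomials p l. \<bar>monomial_val p N J x vs m\<bar>)"
    unfolding covd_form_def
    using sum_list_abs[of "map (monomial_val p N J x vs) (monomials p l)"] by (simp add: o_def)
  also have "\<dots> \<le> (\<Sum>m\<leftarrow>monomials p l. B * s ^ p / s ^ l)"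
    by (intro sum_list_mono mono)
  also have "\<dots> = real p ^ l * (B * s ^ p / s ^ l)"
    by (simp add: sum_list_triv length_monomials)
  finally show ?thesis using s by (simp add: field_simps)
qed

lemma covd_form_diff: "covd_form p N J l x vs - covd_form p N J' l x vs = covd_form p N (\<lambda>is. J is - J' is) l x vs"
proof -
  have "monomial_val p N J x vs m - monomial_val p N J' x vs m = monomial_val p N (\<lambda>is. J is - J' is) x vs m" for m
    by (simp add: monomial_val_def right_diff_distrib[symmetric] mform_diff)
  then show ?thesis unfolding covd_form_def sum_list_subtractf[symmetric] by (simp only:)
qed

lemma covd_form_scale_coeff: "covd_form p N (\<lambda>is. c * J is) l x vs = c * covd_form p N J l x vs"
proof -
  have "monomial_val p N (\<lambda>is. c * J is) x vs m = c * monomial_val p N J x vs m" for m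
    by (simp add: monomial_val_def mform_scale_coeff)
  then have "monomial_val p N (\<lambda>is. c * J is) x vs = (\<lambda>m. c * monomial_val p N J x vs m)"
    by (rule ext)
  then show ?thesis unfolding covd_form_def sum_list_const_mult[symmetric] by (rule arg_cong)
qed

section \<open>Norms of the Hamiltonian\<close>

definition ham_scale :: "nat \<Rightarrow> nat \<Rightarrow> real" where
  "ham_scale p N = real N powr (- (real p - 1) / 2)"

lemma Ham_eq_mform: "Ham p N J = (\<lambda>x. mform p N (\<lambda>is. ham_scale p N * J is) (\<lambda>_. x))"
  by (simp add: Ham_def mform_def ham_scale_def fun_eq_iff sum_distrib_left mult.assoc)

lemma covd_Ham:
  assumes "ip N x x > 0" "\<forall>v\<in>set vs. tangent N x v" "length vs = l"
  shows "covd l N (Ham p N J) x vs = ham_scale p N * covd_form p N J l x vs"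
  unfolding Ham_eq_mform covd_mform[OF assms] covd_form_scale_coeff ..

text \<open>The normalisation of \<open>H\<close> against the factor
  \<open>\<bar>x\<bar> ^ p\<close> on the sphere: what remains is \<open>sqrt N\<close>.\<close>

lemma ham_scale_power:
  assumes "N \<ge> 1"
  shows "ham_scale p N * sqrt N ^ p = sqrt N"
proof -
  have "sqrt N ^ p = real N powr (real p / 2)"
    using assms by (simp add: powr_half_sqrt[symmetric] powr_realpow[symmetric] powr_powr)
  then have "ham_scale p N * sqrt N ^ p = real N powr (1 / 2)"
    using assms by (simp add: ham_scale_def powr_add[symmetric] diff_divide_distrib add_divide_distrib)
  then show ?thesis using assms by (simp add: powr_half_sqrt)
qed

lemma sphere_ip: "x \<in> sphereN N \<Longrightarrow> ip N x x = (sqrt N)\<^sup>2"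
  by (simp add: sphereN_def)

lemma unit_tangent_tangent: "unit_tangent N x v \<Longrightarrow> tangent N x v"
  by (simp add: unit_tangent_def tangent_def)

lemma abs_covd_Ham_le:
  assumes N: "N \<ge> 1" and x: "x \<in> sphereN N" and B: "unit_bounded p N J B" "B \<ge> 0"
    and vs: "\<forall>v\<in>set vs. tangent N x v \<and> ip N v v \<le> 1" "length vs = l"
  shows "\<bar>covd l N (Ham p N J) x vs\<bar> * sqrt N ^ l \<le> real p ^ l * B * sqrt N"
proof -
  have s: "sqrt N > 0" using N by simp
  have pos: "ip N x x > 0" using sphere_ip[OF x] s by simp
  have k: "ham_scale p N \<ge> 0" by (simp add: ham_scale_def)
  have "\<bar>covd l N (Ham p N J) x vs\<bar> * sqrt N ^ l = ham_scale p N * (\<bar>covd_form p N J l x vs\<bar> * sqrt N ^ l)"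
    using covd_Ham[OF pos, of vs l p J] vs k by (simp add: abs_mult)
  also have "\<dots> \<le> ham_scale p N * (real p ^ l * (B * sqrt N ^ p))"
    using abs_covd_form_le[OF B s sphere_ip[OF x]] vs by (intro mult_left_mono k) auto
  also have "\<dots> = real p ^ l * B * (ham_scale p N * sqrt N ^ p)" by (simp add: mult_ac)
  finally show ?thesis by (simp only: ham_scale_power[OF N])
qed

text \<open>A quarter turn of the first two coordinates of \<open>x\<close>, normalised. At points
  of the sphere for \<open>N = 1\<close> there is no unit tangent vector, and for positive order the
  supremum in \<open>opnorm\<close> would range over the empty set.\<close>

lemma unit_tangent_exists:
  assumes N: "N \<ge> 2"
  shows "\<exists>v. unit_tangent N x v"
proof -
  obtain a b :: real where ab: "x 0 * a + x 1 * b = 0" "a \<noteq> 0 \<or> b \<noteq> 0"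
  proof (cases "x 0 = 0 \<and> x 1 = 0")
    case True
    then show ?thesis using that[of 1 0] by simp
  next
    case False
    then show ?thesis using that[of "x 1" "- x 0"] by auto
  qed
  define r where "r = sqrt (a\<^sup>2 + b\<^sup>2)"
  have r2: "r\<^sup>2 = a\<^sup>2 + b\<^sup>2" by (simp add: r_def)
  have r: "r \<noteq> 0" using ab(2) by (auto simp: r_def sum_power2_eq_zero_iff)
  define v where "v i = (if i = 0 then a / r else if i = 1 then b / r else 0)" for i :: nat
  have sum2: "(\<Sum>i<N. f i) = f 0 + f 1" if "\<And>i. i \<ge> 2 \<Longrightarrow> f i = 0" for f :: "nat \<Rightarrow> real"
  proof -
    have "(\<Sum>i<N. f i) = (\<Sum>i\<in>{0,1}. f i)"
      using N that by (intro sum.mono_neutral_right) (auto simp: not_less_eq_eq numeral_2_eq_2 intro: Suc_leI)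
    then show ?thesis by simp
  qed
  have "ip N x v = (x 0 * a + x 1 * b) / r"
    unfolding ip_def by (subst sum2) (auto simp: v_def add_divide_distrib)
  moreover have "ip N v v = (a\<^sup>2 + b\<^sup>2) / r\<^sup>2"
    unfolding ip_def by (subst sum2) (auto simp: v_def add_divide_distrib power2_eq_square)
  ultimately have "unit_tangent N x v"
    using ab(1) r r2 N by (auto simp: unit_tangent_def v_def)
  then show ?thesis by blast
qed

definition north_pole :: "nat \<Rightarrow> nat \<Rightarrow> real" where
  "north_pole N = (\<lambda>i. if i = 0 then sqrt N else 0)"

lemma north_pole_sphere: "N \<ge> 1 \<Longrightarrow> north_pole N \<in> sphereN N"
  by (auto simp: north_pole_def sphereN_def ip_def if_distrib[of "\<lambda>z. z * _"] cong: if_cong)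

lemma opnorm_set_nonempty:
  assumes "N \<ge> 2"
  shows "{\<bar>covd l N F x vs\<bar> | vs. length vs = l \<and> (\<forall>v\<in>set vs. unit_tangent N x v)} \<noteq> {}"
proof -
  obtain v where "unit_tangent N x v" using unit_tangent_exists[OF assms] by blast
  then have "length (replicate l v) = l \<and> (\<forall>w\<in>set (replicate l v). unit_tangent N x w)" by auto
  then show ?thesis by blast
qed

lemma opnorm_Ham_le:
  assumes N: "N \<ge> 2" and x: "x \<in> sphereN N" and B: "unit_bounded p N J B" "B \<ge> 0"
  shows "opnorm l N (Ham p N J) x \<le> real p ^ l * B * sqrt N / sqrt N ^ l"
  unfolding opnorm_def
proof (rule cSup_least[OF opnorm_set_nonempty[OF N]])
  fix y assume "y \<in> {\<bar>covd l N (Ham p N J) x vs\<bar> | vs. length vs = l \<and> (\<forall>v\<in>set vs. unit_tangent N x v)}"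
  then obtain vs where "y = \<bar>covd l N (Ham p N J) x vs\<bar>" "length vs = l" "\<forall>v\<in>set vs. unit_tangent N x v"
    by blast
  then show "y \<le> real p ^ l * B * sqrt N / sqrt N ^ l"
    using abs_covd_Ham_le[OF _ x B, of vs l] N unit_tangent_tangent
    by (auto simp: field_simps unit_tangent_def)
qed

lemma covd_le_opnorm:
  assumes N: "N \<ge> 2" and x: "x \<in> sphereN N" and vs: "length vs = l" "\<forall>v\<in>set vs. unit_tangent N x v"
  shows "\<bar>covd l N (Ham p N J) x vs\<bar> \<le> opnorm l N (Ham p N J) x"
  unfolding opnorm_def
proof (rule cSup_upper)
  let ?B = "\<Sum>is\<in>idx p N. \<bar>J is\<bar>"
  \<comment> \<open>Only finiteness matters here, so the crude bound by the sum of absolute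
    coefficients suffices.\<close>
  have B: "unit_bounded p N J ?B" "?B \<ge> 0" by (auto intro: unit_bounded_l1 sum_nonneg)
  show "bdd_above {\<bar>covd l N (Ham p N J) x vs\<bar> | vs. length vs = l \<and> (\<forall>v\<in>set vs. unit_tangent N x v)}"
  proof (rule bdd_aboveI)
    fix y assume "y \<in> {\<bar>covd l N (Ham p N J) x vs\<bar> | vs. length vs = l \<and> (\<forall>v\<in>set vs. unit_tangent N x v)}"
    then obtain vs where "y = \<bar>covd l N (Ham p N J) x vs\<bar>" "length vs = l" "\<forall>v\<in>set vs. unit_tangent N x v"
      by blast
    then show "y \<le> real p ^ l * ?B * sqrt N / sqrt N ^ l"
      using abs_covd_Ham_le[OF _ x B, of vs l] N unit_tangent_tangent
      by (auto simp: field_simps unit_tangent_def)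
  qed
qed (use vs in blast)

lemma opnorm_nonneg:
  assumes N: "N \<ge> 2" and x: "x \<in> sphereN N"
  shows "opnorm l N (Ham p N J) x \<ge> 0"
proof -
  obtain v where "unit_tangent N x v" using unit_tangent_exists[OF N] by blast
  then show ?thesis
    using covd_le_opnorm[OF N x, of "replicate l v" l p J] by (auto intro: order_trans[rotated])
qed

lemma covd_Ham_diff:
  assumes N: "N \<ge> 1" and x: "x \<in> sphereN N" and vs: "\<forall>v\<in>set vs. tangent N x v" "length vs = l"
  shows "covd l N (Ham p N J) x vs - covd l N (Ham p N J') x vs = covd l N (Ham p N (\<lambda>is. J is - J' is)) x vs"
proof -
  have pos: "ip N x x > 0" using sphere_ip[OF x] N by simp
  show ?thesis
    by (simp only: covd_Ham[OF pos vs] right_diff_distrib[symmetric] covd_form_diff)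
qed

lemma opnorm_Ham_triangle:
  assumes N: "N \<ge> 2" and x: "x \<in> sphereN N"
  shows "opnorm l N (Ham p N J) x \<le> opnorm l N (Ham p N J') x + opnorm l N (Ham p N (\<lambda>is. J is - J' is)) x"
  unfolding opnorm_def[of l N "Ham p N J"]
proof (rule cSup_least[OF opnorm_set_nonempty[OF N]], clarify)
  fix vs assume vs: "\<forall>v\<in>set vs. unit_tangent N x v" "l = length vs"
  have "covd l N (Ham p N J) x vs - covd l N (Ham p N J') x vs = covd l N (Ham p N (\<lambda>is. J is - J' is)) x vs"
    using vs N x by (intro covd_Ham_diff) (auto intro: unit_tangent_tangent)
  moreover have "\<bar>covd l N (Ham p N J') x vs\<bar> \<le> opnorm l N (Ham p N J') x"
    "\<bar>covd l N (Ham p N (\<lambda>is. J is - J' is)) x vs\<bar> \<le> opnorm l N (Ham p N (\<lambda>is. J is - J' is)) x"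
    using vs by (auto intro: covd_le_opnorm[OF N x])
  ultimately show "\<bar>covd (length vs) N (Ham p N J) x vs\<bar>
      \<le> opnorm (length vs) N (Ham p N J') x + opnorm (length vs) N (Ham p N (\<lambda>is. J is - J' is)) x"
    using vs(2) by simp
qed

section \<open>Tail bounds for norms of the disorder\<close>

text \<open>What the tail argument uses of either norm: control by the injective norm of the tensor,
  and the triangle inequality in subtraction form.\<close>

definition disorder_norm :: "nat \<Rightarrow> nat \<Rightarrow> real \<Rightarrow> ((nat list \<Rightarrow> real) \<Rightarrow> real) \<Rightarrow> bool" where
  "disorder_norm p N C \<Phi> \<longleftrightarrow>
     (\<forall>J B. unit_bounded p N J B \<longrightarrow> B \<ge> 0 \<longrightarrow> \<Phi> J \<le> C * B) \<and>
     (\<forall>J J'. \<Phi> J \<le> \<Phi> J' + \<Phi> (\<lambda>is. J is - J' is))"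

lemma disorder_norm_lipschitz:
  assumes "disorder_norm p N C \<Phi>"
  shows "l1_lipschitz (idx p N) \<Phi>"
  unfolding l1_lipschitz_def
proof (intro exI[of _ C] allI)
  have le: "\<Phi> J - \<Phi> J' \<le> C * (\<Sum>is\<in>idx p N. \<bar>J is - J' is\<bar>)" for J J'
  proof -
    have "\<Phi> (\<lambda>is. J is - J' is) \<le> C * (\<Sum>is\<in>idx p N. \<bar>J is - J' is\<bar>)"
      using assms unit_bounded_l1[of p N "\<lambda>is. J is - J' is"] by (auto simp: disorder_norm_def intro: sum_nonneg)
    moreover have "\<Phi> J \<le> \<Phi> J' + \<Phi> (\<lambda>is. J is - J' is)" using assms by (auto simp: disorder_norm_def)
    ultimately show ?thesis by linarith
  qed
  fix J J' :: "nat list \<Rightarrow> real"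
  show "\<bar>\<Phi> J - \<Phi> J'\<bar> \<le> C * (\<Sum>is\<in>idx p N. \<bar>J is - J' is\<bar>)"
    using le[of J J'] le[of J' J] by (simp add: abs_minus_commute abs_le_iff)
qed

text \<open>Positivity of the probability, which includes measurability of the event, matters because
  \<open>ln 0 = 0\<close> and a non-measurable set has measure \<open>0\<close>.\<close>

lemma disorder_norm_tail:
  assumes \<Phi>: "disorder_norm p N C \<Phi>" and N: "N \<ge> 1" and p: "p \<ge> 1"
    and r: "C * (12 * real p ^ 2 * sqrt N) < r" and J0: "\<Phi> J0 > r"
  shows "0 < measure (disorder p N) {J \<in> space (disorder p N). \<Phi> J \<ge> r}"
    and "measure (disorder p N) {J \<in> space (disorder p N). \<Phi> J \<ge> r} \<le> exp (- real N)"
proof -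
  show "0 < measure (disorder p N) {J \<in> space (disorder p N). \<Phi> J \<ge> r}"
    unfolding disorder_def
    by (rule l1_lipschitz_event_pos[OF disorder_norm_lipschitz[OF \<Phi>] finite_idx J0])
next
  interpret prob_space "disorder p N" unfolding disorder_def by (rule prob_space_gaussian_product)
  obtain E where E: "E \<in> sets (disorder p N)" "measure (disorder p N) E \<le> exp (- real N)"
    "\<forall>J \<in> space (disorder p N) - E. unit_bounded p N J (12 * real p ^ 2 * sqrt N)"
    using unit_bounded_tail[OF N p] by blast
  \<comment> \<open>Off the exceptional event the first property of \<open>disorder_norm\<close>
    keeps \<open>\<Phi>\<close> strictly below \<open>r\<close>.\<close>
  have "{J \<in> space (disorder p N). \<Phi> J \<ge> r} \<subseteq> E"
  proof (rule ccontr)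
    assume "\<not> {J \<in> space (disorder p N). \<Phi> J \<ge> r} \<subseteq> E"
    then obtain J where J: "J \<in> space (disorder p N) - E" "\<Phi> J \<ge> r" by blast
    then have "\<Phi> J \<le> C * (12 * real p ^ 2 * sqrt N)"
      using E(3) \<Phi> by (auto simp: disorder_norm_def)
    then show False using J r by simp
  qed
  then show "measure (disorder p N) {J \<in> space (disorder p N). \<Phi> J \<ge> r} \<le> exp (- real N)"
    using finite_measure_mono[OF _ E(1)] E(2) by (meson order_trans)
qed

lemma SUP_le_add:
  fixes f g h :: "'a \<Rightarrow> real"
  assumes "A \<noteq> {}" "\<And>x. x \<in> A \<Longrightarrow> f x \<le> g x + h x" "bdd_above (g ` A)" "bdd_above (h ` A)"
  shows "(SUP x\<in>A. f x) \<le> (SUP x\<in>A. g x) + (SUP x\<in>A. h x)"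
proof (rule cSUP_least[OF assms(1)])
  fix x assume "x \<in> A"
  then show "f x \<le> (SUP x\<in>A. g x) + (SUP x\<in>A. h x)"
    using assms(2)[of x] cSUP_upper[OF _ assms(3)] cSUP_upper[OF _ assms(4)] by (meson add_mono order_trans)
qed

lemma sphere_nonempty: "N \<ge> 2 \<Longrightarrow> sphereN N \<noteq> {}"
  using north_pole_sphere[of N] by auto

lemma bdd_opnorm_Ham:
  assumes N: "N \<ge> 2"
  shows "bdd_above ((\<lambda>x. opnorm l N (Ham p N J) x) ` sphereN N)"
  using opnorm_Ham_le[OF N _ unit_bounded_l1] by (intro bdd_aboveI2) (auto intro: sum_nonneg)

text \<open>The weight \<open>N powr (l / 2)\<close> cancels the decay of the \<open>l\<close>-th
  derivative, so each of the \<open>k + 1\<close> orders contributes at most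
  \<open>p ^ k * B * sqrt N\<close>.\<close>

lemma disorder_norm_Gnorm:
  assumes N: "N \<ge> 2" and p: "p \<ge> 1"
  shows "disorder_norm p N (real (k + 1) * real p ^ k * sqrt N) (\<lambda>J. Gnorm k N (Ham p N J))"
  unfolding disorder_norm_def
proof (intro conjI allI impI)
  fix J B assume B: "unit_bounded p N J B" "B \<ge> 0"
  have "Gnorm k N (Ham p N J) \<le> (\<Sum>l\<le>k. real p ^ k * B * sqrt N)"
    unfolding Gnorm_def
  proof (rule sum_mono)
    fix l assume l: "l \<in> {..k}"
    have pw: "real N powr (real l / 2) = sqrt N ^ l"
      using N by (simp add: powr_half_sqrt[symmetric] powr_realpow[symmetric] powr_powr)
    have "(SUP x\<in>sphereN N. opnorm l N (Ham p N J) x) \<le> real p ^ l * B * sqrt N / sqrt N ^ l"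
      by (rule cSUP_least[OF sphere_nonempty[OF N]]) (rule opnorm_Ham_le[OF N _ B])
    then have "real N powr (real l / 2) * (SUP x\<in>sphereN N. opnorm l N (Ham p N J) x)
        \<le> sqrt N ^ l * (real p ^ l * B * sqrt N / sqrt N ^ l)"
      unfolding pw by (rule mult_left_mono) simp
    also have "\<dots> = real p ^ l * B * sqrt N" using N by simp
    also have "\<dots> \<le> real p ^ k * B * sqrt N"
      using l p B(2) by (intro mult_right_mono power_increasing) auto
    finally show "real N powr (real l / 2) * (SUP x\<in>sphereN N. opnorm l N (Ham p N J) x)
        \<le> real p ^ k * B * sqrt N" .
  qed
  then show "Gnorm k N (Ham p N J) \<le> real (k + 1) * real p ^ k * sqrt N * B"
    by (simp add: mult_ac)
next
  fix J J' :: "nat list \<Rightarrow> real"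
  have "(SUP x\<in>sphereN N. opnorm l N (Ham p N J) x)
     \<le> (SUP x\<in>sphereN N. opnorm l N (Ham p N J') x)
       + (SUP x\<in>sphereN N. opnorm l N (Ham p N (\<lambda>is. J is - J' is)) x)" for l
    by (intro SUP_le_add sphere_nonempty opnorm_Ham_triangle bdd_opnorm_Ham N)
  then show "Gnorm k N (Ham p N J) \<le> Gnorm k N (Ham p N J') + Gnorm k N (Ham p N (\<lambda>is. J is - J' is))"
    unfolding Gnorm_def sum.distrib[symmetric] distrib_left[symmetric]
    by (intro sum_mono mult_left_mono) auto
qed

section \<open>Hilbert--Schmidt norms\<close>

text \<open>Parseval: the inner products of \<open>g\<close> with the projected basis vectors are
  the coordinates of \<open>w\<close>, the tangential part of \<open>g\<close>. Testing the
  hypothesis on \<open>w\<close> normalised bounds its norm.\<close>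

lemma sum_frame_sq_le:
  assumes x: "ip N x x > 0" and K: "\<And>v. tangent N x v \<Longrightarrow> ip N v v \<le> 1 \<Longrightarrow> \<bar>ip N g v\<bar> \<le> K"
  shows "(\<Sum>i<N. (ip N g (proj N x (basis_vec i)))\<^sup>2) \<le> K\<^sup>2"
proof -
  define w where "w = proj N x g"
  have ip_basis: "ip N z (basis_vec i) = z i" if "i < N" for z i
    using that by (simp add: ip_def basis_vec_def if_distrib[of "(*) _"] cong: if_cong)
  have "ip N g (proj N x (basis_vec i)) = w i" if "i < N" for i
    using that by (simp add: ip_proj_right ip_basis ip_commute[of N g x]) (simp add: w_def proj_def)
  then have eq: "(\<Sum>i<N. (ip N g (proj N x (basis_vec i)))\<^sup>2) = ip N w w"
    by (simp add: ip_def power2_eq_square)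
  have gw: "ip N g w = ip N w w"
    using x by (simp add: w_def ip_proj_right ip_proj_proj ip_commute)
  have tw: "tangent N x w" unfolding w_def by (rule tangent_proj[OF x])
  show ?thesis
  proof (cases "ip N w w = 0")
    case False
    then have pos: "ip N w w > 0" using ip_nonneg[of N w] by linarith
    define c where "c = 1 / sqrt (ip N w w)"
    have c2: "c * c * ip N w w = 1" using pos by (simp add: c_def)
    have "tangent N x (\<lambda>i. c * w i)" using tw by (simp add: tangent_def ip_scale_right)
    moreover have "ip N (\<lambda>i. c * w i) (\<lambda>i. c * w i) \<le> 1"
      using c2 by (simp add: ip_scale_left ip_scale_right mult.assoc)
    ultimately have "\<bar>ip N g (\<lambda>i. c * w i)\<bar> \<le> K" by (rule K)
    then have "\<bar>c * ip N w w\<bar> \<le> K" by (simp add: ip_scale_right gw)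
    then have "(c * ip N w w)\<^sup>2 \<le> K\<^sup>2" by (metis abs_ge_zero power2_abs power_mono)
    moreover have "(c * ip N w w)\<^sup>2 = (c * c * ip N w w) * ip N w w" by (simp add: power2_eq_square)
    ultimately show ?thesis by (simp add: eq c2)
  qed (simp add: eq)
qed

lemma frame_tangent:
  assumes "ip N x x > 0" "j < N"
  shows "tangent N x (proj N x (basis_vec j))"
    and "ip N (proj N x (basis_vec j)) (proj N x (basis_vec j)) \<le> 1"
proof -
  have "ip N (basis_vec j) (basis_vec j) = 1"
    using assms(2) by (simp add: ip_def basis_vec_def if_distrib[of "\<lambda>z. z * _"] cong: if_cong)
  moreover have "ip N x (basis_vec j) * ip N x (basis_vec j) / ip N x x \<ge> 0" by simp
  ultimately show "ip N (proj N x (basis_vec j)) (proj N x (basis_vec j)) \<le> 1"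
    by (simp only: ip_proj_proj[OF assms(1)])
qed (rule tangent_proj[OF assms(1)])

lemma card_idx: "card (idx p N) = N ^ p"
  using card_lists_length_eq[of "{..<N}" p] by (simp add: idx_def conj_commute)

lemma hs_sq_idx: "hs_sq k N F x = (\<Sum>is\<in>idx k N. (covd k N F x (map (\<lambda>j. proj N x (basis_vec j)) is))\<^sup>2)"
  by (simp add: hs_sq_def idx_def)

text \<open>For fixed later indices, linearity bounds the sum over the first index by
  \<open>K\<^sup>2\<close> without a dimension factor. The remaining \<open>N ^ l\<close> index
  tuples are compensated by the denominator \<open>sqrt N ^ l\<close> in \<open>K\<close>.\<close>

lemma hs_sq_Ham_le:
  assumes N: "N \<ge> 1" and x: "x \<in> sphereN N" and B: "unit_bounded p N J B" "B \<ge> 0"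
  shows "hs_sq (Suc l) N (Ham p N J) x \<le> (real p ^ Suc l * B)\<^sup>2"
proof -
  define K where "K = real p ^ Suc l * B / sqrt N ^ l"
  have pos: "ip N x x > 0" using sphere_ip[OF x] N by simp
  let ?e = "\<lambda>j. proj N x (basis_vec j)"
  have inner: "(\<Sum>i<N. (covd (Suc l) N (Ham p N J) x (?e i # map ?e is))\<^sup>2) \<le> K\<^sup>2" if i: "is \<in> idx l N" for "is"
  proof -
    let ?vs = "map ?e is"
    have len: "length ?vs = l" and vs: "\<forall>v\<in>set ?vs. tangent N x v \<and> ip N v v \<le> 1"
      using i frame_tangent[OF pos] by (auto simp: idx_def)
    obtain g0 where g0: "\<And>v. covd_form p N J (Suc l) x (v # ?vs) = ip N g0 v"
      using covd_form_head_linear[of p N J l x ?vs] by blast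
    define g where "g = (\<lambda>i. ham_scale p N * g0 i)"
    have g: "covd (Suc l) N (Ham p N J) x (v # ?vs) = ip N g v" if "tangent N x v" for v
      using that vs len by (subst covd_Ham[OF pos]) (auto simp: g0 g_def ip_scale_left)
    have "(\<Sum>i<N. (ip N g (?e i))\<^sup>2) \<le> K\<^sup>2"
    proof (rule sum_frame_sq_le[OF pos])
      fix v assume v: "tangent N x v" "ip N v v \<le> 1"
      have "\<bar>ip N g v\<bar> * sqrt N ^ Suc l \<le> real p ^ Suc l * B * sqrt N"
        using abs_covd_Ham_le[OF N x B, of "v # ?vs" "Suc l"] v vs len by (simp add: g[OF v(1)] del: covd.simps)
      then show "\<bar>ip N g v\<bar> \<le> K" using N by (simp add: K_def field_simps)
    qed
    then show ?thesis using frame_tangent(1)[OF pos] by (simp add: g del: covd.simps)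
  qed
  have "hs_sq (Suc l) N (Ham p N J) x
      = (\<Sum>is\<in>idx l N. \<Sum>i<N. (covd (Suc l) N (Ham p N J) x (?e i # map ?e is))\<^sup>2)"
    unfolding hs_sq_idx sum_idx_Suc by (subst sum.swap) (simp del: covd.simps)
  also have "\<dots> \<le> (\<Sum>is\<in>idx l N. K\<^sup>2)" by (intro sum_mono inner)
  also have "\<dots> = (sqrt N ^ l)\<^sup>2 * K\<^sup>2"
    by (simp add: card_idx power_mult[symmetric] mult.commute[of l]) (simp add: power_mult)
  also have "\<dots> = (real p ^ Suc l * B)\<^sup>2"
    using N by (simp add: K_def power_mult_distrib[symmetric])
  finally show ?thesis .
qed

lemma sqrt_hs_sq_L2:
  "sqrt (hs_sq k N F x) = L2_set (\<lambda>is. covd k N F x (map (\<lambda>j. proj N x (basis_vec j)) is)) (idx k N)"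
  by (simp add: hs_sq_idx L2_set_def)

text \<open>Minkowski's inequality for the array of components, each of which is linear in
  \<open>J\<close>.\<close>

lemma sqrt_hs_sq_triangle:
  assumes N: "N \<ge> 1" and x: "x \<in> sphereN N"
  shows "sqrt (hs_sq k N (Ham p N J) x)
    \<le> sqrt (hs_sq k N (Ham p N J') x) + sqrt (hs_sq k N (Ham p N (\<lambda>is. J is - J' is)) x)"
proof -
  have pos: "ip N x x > 0" using sphere_ip[OF x] N by simp
  let ?f = "\<lambda>J is. covd k N (Ham p N J) x (map (\<lambda>j. proj N x (basis_vec j)) is)"
  have "?f J is = ?f J' is + ?f (\<lambda>is. J is - J' is) is" if "is \<in> idx k N" for "is"
  proof -
    have "\<forall>v\<in>set (map (\<lambda>j. proj N x (basis_vec j)) is). tangent N x v" "length (map (\<lambda>j. proj N x (basis_vec j)) is) = k"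
      using that frame_tangent(1)[OF pos] by (auto simp: idx_def)
    from covd_Ham_diff[OF N x this, of p J J'] show ?thesis by linarith
  qed
  then have "L2_set (?f J) (idx k N) = L2_set (\<lambda>is. ?f J' is + ?f (\<lambda>is. J is - J' is) is) (idx k N)"
    by (intro L2_set_cong) auto
  also have "\<dots> \<le> L2_set (?f J') (idx k N) + L2_set (?f (\<lambda>is. J is - J' is)) (idx k N)"
    by (rule L2_set_triangle_ineq)
  finally show ?thesis unfolding sqrt_hs_sq_L2 .
qed

lemma sqrt_hs_sq_Ham_le:
  assumes "N \<ge> 1" "x \<in> sphereN N" "unit_bounded p N J B" "B \<ge> 0" "k \<ge> 1"
  shows "sqrt (hs_sq k N (Ham p N J) x) \<le> real p ^ k * B"
proof -
  obtain l where "k = Suc l" using assms(5) by (cases k) auto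
  then show ?thesis using hs_sq_Ham_le[OF assms(1-4), of l] assms(4) by (intro real_le_lsqrt) auto
qed

lemma bdd_sqrt_hs_sq_Ham:
  assumes "N \<ge> 1" "k \<ge> 1"
  shows "bdd_above ((\<lambda>x. sqrt (hs_sq k N (Ham p N J) x)) ` sphereN N)"
  using sqrt_hs_sq_Ham_le[OF assms(1) _ unit_bounded_l1 _ assms(2)]
  by (intro bdd_aboveI2) (auto intro: sum_nonneg)

lemma disorder_norm_Wnorm:
  assumes N: "N \<ge> 2" and k: "k \<ge> 1"
  shows "disorder_norm p N (real p ^ k) (\<lambda>J. Wnorm k N (Ham p N J))"
  unfolding disorder_norm_def Wnorm_def
proof (intro conjI allI impI)
  fix J B assume "unit_bounded p N J B" "B \<ge> 0"
  then show "(SUP x\<in>sphereN N. sqrt (hs_sq k N (Ham p N J) x)) \<le> real p ^ k * B"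
    using N k by (intro cSUP_least sphere_nonempty sqrt_hs_sq_Ham_le) auto
next
  fix J J' :: "nat list \<Rightarrow> real"
  show "(SUP x\<in>sphereN N. sqrt (hs_sq k N (Ham p N J) x))
    \<le> (SUP x\<in>sphereN N. sqrt (hs_sq k N (Ham p N J') x))
      + (SUP x\<in>sphereN N. sqrt (hs_sq k N (Ham p N (\<lambda>is. J is - J' is)) x))"
    using N k by (intro SUP_le_add sphere_nonempty sqrt_hs_sq_triangle bdd_sqrt_hs_sq_Ham) auto
qed

section \<open>Disorders with arbitrarily large norms\<close>

definition unit_disorder :: "nat list \<Rightarrow> nat list \<Rightarrow> real" where
  "unit_disorder is0 = (\<lambda>is. if is = is0 then 1 else 0)"

lemma mform_unit_disorder: "is0 \<in> idx p N \<Longrightarrow> mform p N (unit_disorder is0) a = (\<Prod>j<p. a j (is0 ! j))"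
  by (simp add: mform_def unit_disorder_def if_distrib[of "\<lambda>z. z * _"] sum.delta cong: if_cong)

lemma north_pole_ip: "N \<ge> 1 \<Longrightarrow> ip N (north_pole N) (north_pole N) > 0"
  using sphere_ip[OF north_pole_sphere] by simp

text \<open>The order-zero term alone is large: a multiple of the monomial \<open>x 0 ^ p\<close> is
  evaluated at the north pole.\<close>

lemma Gnorm_Ham_unbounded:
  assumes N: "N \<ge> 2"
  shows "\<exists>J. Gnorm k N (Ham p N J) > r"
proof -
  have N1: "N \<ge> 1" using N by simp
  note x = north_pole_sphere[OF N1]
  \<comment> \<open>Since \<open>ham_scale p N * sqrt N ^ p = sqrt N\<close>, this makes
    \<open>H\<close> equal to \<open>\<bar>r\<bar> + 1\<close> at the north pole.\<close>
  define c where "c = (\<bar>r\<bar> + 1) / sqrt N"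
  define J where "J = (\<lambda>is. c * unit_disorder (replicate p 0) is)"
  have i: "replicate p 0 \<in> idx p N" using N by (auto simp: idx_def)
  have "Ham p N J (north_pole N) = c * (ham_scale p N * sqrt N ^ p)"
    by (simp add: Ham_eq_mform J_def mform_scale_coeff mform_unit_disorder[OF i] north_pole_def)
  also have "\<dots> = \<bar>r\<bar> + 1" using N by (simp add: ham_scale_power[OF N1] c_def)
  finally have "\<bar>r\<bar> + 1 \<le> \<bar>covd 0 N (Ham p N J) (north_pole N) []\<bar>" by simp
  also have "\<dots> \<le> opnorm 0 N (Ham p N J) (north_pole N)"
    by (rule covd_le_opnorm[OF N x]) auto
  also have "\<dots> \<le> (SUP x\<in>sphereN N. opnorm 0 N (Ham p N J) x)"
    by (rule cSUP_upper[OF x bdd_opnorm_Ham[OF N]])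
  also have "\<dots> = (\<Sum>l\<in>{0}. real N powr (real l / 2) * (SUP x\<in>sphereN N. opnorm l N (Ham p N J) x))"
    using N by simp
  also have "\<dots> \<le> Gnorm k N (Ham p N J)"
    unfolding Gnorm_def
  proof (rule sum_mono2)
    fix l
    have "0 \<le> (SUP x\<in>sphereN N. opnorm l N (Ham p N J) x)"
      using opnorm_nonneg[OF N x] cSUP_upper[OF x bdd_opnorm_Ham[OF N]] order_trans by blast
    then show "0 \<le> real N powr (real l / 2) * (SUP x\<in>sphereN N. opnorm l N (Ham p N J) x)" by simp
  qed auto
  finally have "\<bar>r\<bar> + 1 \<le> Gnorm k N (Ham p N J)" .
  then show ?thesis by (intro exI[of _ J]) linarith
qed

text \<open>One nonvanishing component at one point is enough, since the derivative scales linearly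
  with the disorder.\<close>

lemma Wnorm_Ham_unboundedI:
  assumes N: "N \<ge> 2" and k: "k \<ge> 1"
    and nz: "covd_form p N J0 k (north_pole N) (replicate k (basis_vec 1)) \<noteq> 0"
  shows "\<exists>J. Wnorm k N (Ham p N J) > r"
proof -
  have N1: "N \<ge> 1" using N by simp
  let ?x = "north_pole N"
  note x = north_pole_sphere[OF N1] and pos = north_pole_ip[OF N1]
  define y where "y = ham_scale p N * covd_form p N J0 k ?x (replicate k (basis_vec 1))"
  define c where "c = (\<bar>r\<bar> + 1) / y"
  define J where "J = (\<lambda>is. c * J0 is)"
  have t: "tangent N ?x (basis_vec 1)"
    unfolding tangent_def ip_def using N
    by (auto simp: basis_vec_def north_pole_def intro!: sum.neutral)
  \<comment> \<open>Thus \<open>basis_vec 1\<close> is itself a member of the frame over which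
    \<open>hs_sq\<close> sums.\<close>
  then have p1: "proj N ?x (basis_vec 1) = basis_vec 1" by (rule proj_tangent)
  have "covd k N (Ham p N J) ?x (replicate k (basis_vec 1)) = c * y"
    using t by (subst covd_Ham[OF pos]) (auto simp: J_def covd_form_scale_coeff y_def)
  moreover have "y \<noteq> 0" using nz N by (simp add: y_def ham_scale_def)
  ultimately have v: "covd k N (Ham p N J) ?x (replicate k (basis_vec 1)) = \<bar>r\<bar> + 1"
    by (simp add: c_def)
  have "(covd k N (Ham p N J) ?x (map (\<lambda>j. proj N ?x (basis_vec j)) (replicate k 1)))\<^sup>2 \<le> hs_sq k N (Ham p N J) ?x"
    unfolding hs_sq_idx
  proof (rule member_le_sum)
    show "replicate k 1 \<in> idx k N" using N by (auto simp: idx_def)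
  qed auto
  then have "(\<bar>r\<bar> + 1)\<^sup>2 \<le> hs_sq k N (Ham p N J) ?x" using v p1 by (simp add: map_replicate)
  then have "\<bar>r\<bar> + 1 \<le> sqrt (hs_sq k N (Ham p N J) ?x)" by (rule real_le_rsqrt)
  also have "\<dots> \<le> Wnorm k N (Ham p N J)"
    unfolding Wnorm_def by (rule cSUP_upper[OF x bdd_sqrt_hs_sq_Ham[OF N1 k]])
  finally show ?thesis by (intro exI[of _ J]) linarith
qed

text \<open>The polynomial is \<open>x 1 * x 0 ^ (p - 1)\<close>. Differentiating along
  \<open>basis_vec 1\<close> at the north pole, only the slot \<open>j = 0\<close> of the product
  rule survives.\<close>

lemma covd_form_1_nonzero:
  assumes N: "N \<ge> 2" and p: "p \<ge> 1"
  shows "covd_form p N (unit_disorder (1 # replicate (p - 1) 0)) 1 (north_pole N) [basis_vec 1] \<noteq> 0"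
proof -
  let ?is = "1 # replicate (p - 1) (0::nat)" and ?x = "north_pole N"
  have i: "?is \<in> idx p N" using N p by (auto simp: idx_def)
  have "covd_form p N (unit_disorder ?is) 1 ?x [basis_vec 1]
     = (\<Sum>j<p. mform p N (unit_disorder ?is) ((\<lambda>_. ?x)(j := basis_vec 1)))"
    by (simp add: covd_form_Suc monomial_val_diff_slot slot_vec_def pairs_val_def)
  also have "\<dots> = (\<Sum>j<p. if j = 0 then sqrt N ^ (p - 1) else 0)"
  proof (rule sum.cong[OF refl])
    fix j assume j: "j \<in> {..<p}"
    have "(\<Prod>k<p. ((\<lambda>_. ?x)(j := basis_vec 1)) k (?is ! k))
        = ((\<lambda>_. ?x)(j := basis_vec 1)) 0 1 * (\<Prod>k<p - 1. ((\<lambda>_. ?x)(j := basis_vec 1)) (Suc k) (replicate (p - 1) 0 ! k))"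
      using p by (cases p) (simp_all add: prod.lessThan_Suc_shift del: prod.lessThan_Suc)
    also have "\<dots> = (if j = 0 then sqrt N ^ (p - 1) else 0)"
      by (simp add: basis_vec_def north_pole_def)
    finally show "mform p N (unit_disorder ?is) ((\<lambda>_. ?x)(j := basis_vec 1)) = (if j = 0 then sqrt N ^ (p - 1) else 0)"
      unfolding mform_unit_disorder[OF i] .
  qed
  also have "\<dots> = sqrt N ^ (p - 1)" using p by simp
  finally show ?thesis using N by simp
qed

text \<open>For \<open>x 0 ^ p\<close> the flat second derivative along \<open>basis_vec 1\<close>
  vanishes at the north pole, but the curvature of the sphere contributes
  \<open>- p * sqrt N ^ p / N\<close>.\<close>

lemma covd_form_2_nonzero:
  assumes N: "N \<ge> 2" and p: "p \<ge> 1"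
  shows "covd_form p N (unit_disorder (replicate p 0)) 2 (north_pole N) [basis_vec 1, basis_vec 1] \<noteq> 0"
proof -
  let ?x = "north_pole N" and ?e = "basis_vec 1" and ?J = "unit_disorder (replicate p 0)"
  have i: "replicate p 0 \<in> idx p N" using N by (auto simp: idx_def)
  have ee: "ip N ?e ?e = 1"
    using N by (simp add: ip_def basis_vec_def if_distrib[of "\<lambda>z. z * _"] cong: if_cong)
  have e0: "?e 0 = 0" by (simp add: basis_vec_def)
  have "monomial_val p N ?J ?x [?e, ?e] (diff_slot (diff_slot ([], \<lambda>_. 0) i) j)
      = (if j = i then - 1 / ip N ?x ?x * sqrt N ^ p else 0)" if "i < p" "j < p" for i j
  proof -
    define \<sigma> where "\<sigma> = (lift_slots (\<lambda>_. 0))(i := 1)"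
    have d: "diff_slot ([], \<lambda>_. 0) i = ([], \<sigma>)" by (simp add: diff_slot_def \<sigma>_def lift_pairs_def)
    have \<sigma>: "\<sigma> k = (if k = i then 1 else 0)" for k by (simp add: \<sigma>_def lift_slots_def)
    let ?a = "(slot_vec ?x [?e] \<sigma>)(j := if \<sigma> j = 0 then ?e else (\<lambda>i. - ip N ?e ([?e] ! (\<sigma> j - 1)) / ip N ?x ?x * ?x i))"
    have "monomial_val p N ?J ?x [?e, ?e] (diff_slot ([], \<sigma>) j) = (\<Prod>k<p. ?a k 0)"
      by (subst monomial_val_diff_slot[OF that(2)])
         (simp add: pairs_val_def mform_unit_disorder[OF i])
    also have "\<dots> = (if j = i then - 1 / ip N ?x ?x * sqrt N ^ p else 0)"
    proof (cases "j = i")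
      case True
      have "(\<Prod>k<p. ?a k 0) = ?a i 0 * (\<Prod>k\<in>{..<p} - {i}. ?a k 0)"
        using that by (intro prod.remove) auto
      also have "(\<Prod>k\<in>{..<p} - {i}. ?a k 0) = (\<Prod>k\<in>{..<p} - {i}. sqrt N)"
        using True by (intro prod.cong) (auto simp: slot_vec_def \<sigma> north_pole_def)
      also have "?a i 0 * \<dots> = - 1 / ip N ?x ?x * (sqrt N * sqrt N ^ (p - 1))"
        using True that by (simp add: \<sigma> ee north_pole_def card_Diff_singleton del: One_nat_def)
      also have "sqrt N * sqrt N ^ (p - 1) = sqrt N ^ p"
        using p by (simp add: power_eq_if)
      finally show ?thesis using True by simp
    next
      case False
      \<comment> \<open>For distinct slots \<open>basis_vec 1\<close> stays in slot
        \<open>i\<close>, where the coefficient tensor reads its vanishing coordinate 0.\<close>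
      have "?a i 0 = 0" using False e0 by (simp add: slot_vec_def \<sigma>)
      then show ?thesis using False that by (subst prod_zero) auto
    qed
    finally show ?thesis by (simp add: d)
  qed
  then have "covd_form p N ?J 2 ?x [?e, ?e] = (\<Sum>i<p. \<Sum>j<p. if j = i then - 1 / ip N ?x ?x * sqrt N ^ p else 0)"
    by (simp only: numeral_2_eq_2 covd_form_Suc monomials.simps sum_list_concat_upt) simp
  also have "\<dots> = real p * (- 1 / ip N ?x ?x * sqrt N ^ p)" by simp
  finally show ?thesis using N p north_pole_ip[of N] by simp
qed

lemma Wnorm_Ham_unbounded:
  assumes N: "N \<ge> 2" and p: "p \<ge> 1" and k: "k \<in> {1, 2}"
  shows "\<exists>J. Wnorm k N (Ham p N J) > r"
proof (cases "k = 1")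
  case True
  then show ?thesis using covd_form_1_nonzero[OF N p] by (intro Wnorm_Ham_unboundedI[OF N]) auto
next
  case False
  then have "k = 2" using k by simp
  then show ?thesis using covd_form_2_nonzero[OF N p]
    by (intro Wnorm_Ham_unboundedI[OF N]) (auto simp: numeral_2_eq_2)
qed

section \<open>Choice of constants and conclusion\<close>

theorem mainTheorem8:
  shows "\<exists>(c :: nat \<Rightarrow> real) (K1 :: nat \<Rightarrow> nat \<Rightarrow> real) (K2 :: nat \<Rightarrow> nat \<Rightarrow> real).
    (\<forall>p\<ge>3. c p > 0) \<and>
    (\<forall>p\<ge>3. \<forall>k\<ge>1. K1 p k > 0 \<and> K2 p k > 0) \<and>
    (\<forall>k\<ge>1. \<exists>(C :: real) (d :: nat). \<forall>p\<ge>3. K1 p k \<le> C * real p ^ d) \<and>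
    (\<forall>p\<ge>3. \<forall>k\<ge>1.
       limsup (\<lambda>N. ereal (1 / real N * ln (measure (disorder p N)
          {J \<in> space (disorder p N). Gnorm k N (Ham p N J) \<ge> K1 p k * real N})))
       \<le> ereal (- c p)) \<and>
    (\<forall>p\<ge>3. \<forall>k\<in>{1,2}.
       limsup (\<lambda>N. ereal (1 / real N * ln (measure (disorder p N)
          {J \<in> space (disorder p N). Wnorm k N (Ham p N J) \<ge> K2 p k * sqrt (real N)})))
       \<le> ereal (- c p))"
proof (intro exI conjI)
  let ?c = "\<lambda>_::nat. 1 :: real"
  \<comment> \<open>The constant 13 strictly exceeds the 12 of the tail bound; \<open>p ^ k\<close>
    comes from the \<open>k\<close>-th derivative and \<open>p ^ 2\<close> from the supremum of the
    form. For fixed \<open>k\<close> this is already polynomial in \<open>p\<close>.\<close>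
  let ?K1 = "\<lambda>p k. 13 * real (k + 1) * real p ^ (k + 2)"
  let ?K2 = "\<lambda>p k. 13 * real p ^ (k + 2)"
  show "\<forall>p\<ge>3. ?c p > 0" by simp
  show "\<forall>p\<ge>3. \<forall>k\<ge>1. ?K1 p k > 0 \<and> ?K2 p k > 0" by auto
  show "\<forall>k\<ge>1. \<exists>(C :: real) (d :: nat). \<forall>p\<ge>3. ?K1 p k \<le> C * real p ^ d" by blast
  show "\<forall>p\<ge>3. \<forall>k\<ge>1. limsup (\<lambda>N. ereal (1 / real N * ln (measure (disorder p N)
          {J \<in> space (disorder p N). Gnorm k N (Ham p N J) \<ge> ?K1 p k * real N}))) \<le> ereal (- ?c p)"
  proof (intro allI impI, rule limsup_log_prob_le, rule eventually_mono[OF eventually_ge_at_top[of 2]])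
    fix p k N :: nat assume p: "3 \<le> p" and N: "2 \<le> N"
    let ?\<Phi> = "\<lambda>J. Gnorm k N (Ham p N J)" and ?r = "?K1 p k * real N"
    have p1: "p \<ge> 1" and N1: "N \<ge> 1" using p N by auto
    have "real (k + 1) * real p ^ k * sqrt N * (12 * real p ^ 2 * sqrt N) = 12 * real (k + 1) * real p ^ (k + 2) * real N"
    proof -
      have "a * b * y * (12 * q * y) = 12 * a * (b * q) * (y * y)" for a b q y :: real by (simp add: mult_ac)
      then show ?thesis by (simp only: power_add real_sqrt_mult_self abs_of_nat)
    qed
    also have "\<dots> < ?r" using p N by (intro mult_strict_right_mono) auto
    finally have r: "real (k + 1) * real p ^ k * sqrt N * (12 * real p ^ 2 * sqrt N) < ?r" .
    \<comment> \<open>One disorder above the threshold makes the event of positive probability, so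
      its logarithm is meaningful.\<close>
    obtain J0 where "?\<Phi> J0 > ?r" using Gnorm_Ham_unbounded[OF N] by blast
    from disorder_norm_tail[OF disorder_norm_Gnorm[OF N p1] N1 p1 r this]
    show "0 < measure (disorder p N) {J \<in> space (disorder p N). ?\<Phi> J \<ge> ?r} \<and>
        measure (disorder p N) {J \<in> space (disorder p N). ?\<Phi> J \<ge> ?r} \<le> exp (- (1 * real N))" by simp
  qed
  show "\<forall>p\<ge>3. \<forall>k\<in>{1,2}. limsup (\<lambda>N. ereal (1 / real N * ln (measure (disorder p N)
          {J \<in> space (disorder p N). Wnorm k N (Ham p N J) \<ge> ?K2 p k * sqrt (real N)}))) \<le> ereal (- ?c p)"
  proof (intro allI impI ballI, rule limsup_log_prob_le, rule eventually_mono[OF eventually_ge_at_top[of 2]])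
    fix p k N :: nat assume p: "3 \<le> p" and k: "k \<in> {1, 2}" and N: "2 \<le> N"
    let ?\<Phi> = "\<lambda>J. Wnorm k N (Ham p N J)" and ?r = "?K2 p k * sqrt (real N)"
    have p1: "p \<ge> 1" and N1: "N \<ge> 1" and k1: "k \<ge> 1" using p N k by auto
    have "real p ^ k * (12 * real p ^ 2 * sqrt N) = 12 * real p ^ (k + 2) * sqrt N"
      by (simp add: power_add power2_eq_square)
    also have "\<dots> < ?r" using p N by (intro mult_strict_right_mono) auto
    finally have r: "real p ^ k * (12 * real p ^ 2 * sqrt N) < ?r" .
    obtain J0 where "?\<Phi> J0 > ?r" using Wnorm_Ham_unbounded[OF N p1 k] by blast
    from disorder_norm_tail[OF disorder_norm_Wnorm[OF N k1] N1 p1 r this]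
    show "0 < measure (disorder p N) {J \<in> space (disorder p N). ?\<Phi> J \<ge> ?r} \<and>
        measure (disorder p N) {J \<in> space (disorder p N). ?\<Phi> J \<ge> ?r} \<le> exp (- (1 * real N))" by simp
  qed
qed

end
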